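(* Let $(R,\mathfrak m)$ be a Noetherian local ring and $M$ a finite $R$-module with $\dim M=d\ge 1$. Let $J$ be an ideal generated by a system of parameters for $M$. Then $e_1(J,M)\le 0$.
   Context: $\lambda$ denotes length as an $R$-module. A system of parameters for $M$ is a sequence of $d=\dim M$ elements of $\mathfrak m$ generating an ideal $J$ with $\lambda(M/JM)<\infty$. The function $n\mapsto\lambda(M/J^{n+1}M)$ agrees for $n\gg0$ with a polynomial $P_J(M,X)\in\mathbb Q[X]$ of degree $d$; write $P_J(M,X)=\sum_{i=0}^d(-1)^ie_i(J,M)\binom{X+d-i}{d-i}$ with integers $e_i(J,M)$. The integer $e_1(J,M)$ is the Chern number of $J$ with respect to $M$. *)

theory Defs
  imports
    "HOL-Computational_Algebra.Polynomial"
    "HOL-Library.Extended_Nat"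
    "HOL-Algebra.Ring_Divisibility"
    "HOL-Algebra.Ideal_Product"
    "HOL-Algebra.Module"
begin

section \<open>Noetherian local rings and finite modules\<close>

locale noetherian_local_ring = noetherian_ring R + cring R for R (structure) and \<mm> +
  assumes maximal: "maximalideal \<mm> R"
    and maximal_unique: "maximalideal I R \<Longrightarrow> I = \<mm>"

definition submodule_span :: "('a, 'r) ring_scheme \<Rightarrow> ('a, 'b, 'm) module_scheme \<Rightarrow> 'b set \<Rightarrow> 'b set"
  where "submodule_span R M S = \<Inter> {N. submodule N R M \<and> S \<subseteq> N}"

definition finite_module :: "('a, 'r) ring_scheme \<Rightarrow> ('a, 'b, 'm) module_scheme \<Rightarrow> bool"
  where "finite_module R M \<longleftrightarrow>
    module R M \<and> (\<exists>S \<subseteq> carrier M. finite S \<and> submodule_span R M S = carrier M)"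

definition ideal_smult :: "('a, 'r) ring_scheme \<Rightarrow> 'a set \<Rightarrow> ('a, 'b, 'm) module_scheme \<Rightarrow> 'b set"
  where "ideal_smult R I M = submodule_span R M {a \<odot>\<^bsub>M\<^esub> x | a x. a \<in> I \<and> x \<in> carrier M}"

text \<open>The ring multiplication and unit of a module record carry no meaning; both are given dummy
  values here.\<close>

definition quotient_module :: "('a, 'b, 'm) module_scheme \<Rightarrow> 'b set \<Rightarrow> ('a, 'b set) module"
  where "quotient_module M N =
    \<lparr>carrier = a_rcosets\<^bsub>M\<^esub> N, mult = (\<lambda>_ _. N), one = N, zero = N, add = set_add M,
     smult = (\<lambda>a X. \<Union>x\<in>X. N +>\<^bsub>M\<^esub> (a \<odot>\<^bsub>M\<^esub> x))\<rparr>"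


section \<open>Length and dimension\<close>

definition module_length :: "('a, 'r) ring_scheme \<Rightarrow> ('a, 'b, 'm) module_scheme \<Rightarrow> enat"
  where "module_length R M =
    Sup {enat n | n. \<exists>N. (\<forall>i\<le>n. submodule (N i) R M) \<and> (\<forall>i<n. N i \<subset> N (Suc i))}"

text \<open>The zero ring gets dimension \<open>0\<close>, the supremum of the empty set of type \<^typ>\<open>enat\<close>;
  so does the zero module below.\<close>

definition krull_dim :: "('a, 'r) ring_scheme \<Rightarrow> enat"
  where "krull_dim R =
    Sup {enat n | n. \<exists>P. (\<forall>i\<le>n. primeideal (P i) R) \<and> (\<forall>i<n. P i \<subset> P (Suc i))}"

definition annihilator :: "('a, 'r) ring_scheme \<Rightarrow> ('a, 'b, 'm) module_scheme \<Rightarrow> 'a set"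
  where "annihilator R M = {a \<in> carrier R. \<forall>x \<in> carrier M. a \<odot>\<^bsub>M\<^esub> x = \<zero>\<^bsub>M\<^esub>}"

definition module_dim :: "('a, 'r) ring_scheme \<Rightarrow> ('a, 'b, 'm) module_scheme \<Rightarrow> enat"
  where "module_dim R M = krull_dim (R Quot annihilator R M)"

definition system_of_parameters ::
    "('a, 'r) ring_scheme \<Rightarrow> 'a set \<Rightarrow> ('a, 'b, 'm) module_scheme \<Rightarrow> 'a list \<Rightarrow> bool"
  where "system_of_parameters R \<mm> M xs \<longleftrightarrow>
    enat (length xs) = module_dim R M \<and> set xs \<subseteq> \<mm> \<and>
    module_length R (quotient_module M (ideal_smult R (genideal R (set xs)) M)) < \<infinity>"


section \<open>Hilbert polynomial and Hilbert coefficients\<close>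

text \<open>Powers of ideals are powers in the semiring \<^const>\<open>ideals_set\<close> of ideals.\<close>

definition hilbert_function ::
    "('a, 'r) ring_scheme \<Rightarrow> 'a set \<Rightarrow> ('a, 'b, 'm) module_scheme \<Rightarrow> nat \<Rightarrow> enat"
  where "hilbert_function R J M n =
    module_length R (quotient_module M (ideal_smult R (J [^]\<^bsub>ideals_set R\<^esub> Suc n) M))"

text \<open>Two polynomials agreeing at all large \<open>n\<close> are equal, so at most one polynomial satisfies the
  condition below.\<close>

definition hilbert_poly ::
    "('a, 'r) ring_scheme \<Rightarrow> 'a set \<Rightarrow> ('a, 'b, 'm) module_scheme \<Rightarrow> rat poly"
  where "hilbert_poly R J M = (THE P. \<forall>\<^sub>F n in sequentially.
    \<exists>l. hilbert_function R J M n = enat l \<and> poly P (of_nat n) = of_nat l)"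

text \<open>The polynomial \<open>binom(X + k, k) = (X + 1) \<dots> (X + k) / k!\<close>.\<close>

definition binomial_poly :: "nat \<Rightarrow> rat poly"
  where "binomial_poly k = Polynomial.smult (1 / fact k) (pochhammer [:1, 1:] k)"

lemma poly_binomial_poly: "poly (binomial_poly k) (of_nat n) = of_nat ((n + k) choose k)"
proof -
  have "poly (pochhammer [:1, 1:] k) x = pochhammer (1 + x) k" for x :: rat
    by (induction k) (simp_all add: pochhammer_Suc algebra_simps of_nat_poly)
  moreover have "(of_nat ((n + k) choose k) :: rat) = pochhammer (of_nat n + 1) k / fact k"
    by (simp add: binomial_gbinomial gbinomial_pochhammer')
  ultimately show ?thesis
    by (simp add: binomial_poly_def add.commute)
qed

text \<open>The polynomials \<open>binom(X + k, k)\<close> are linearly independent; the coefficients \<open>e\<^sub>0, \<dots>, e\<^sub>d\<close> are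
  thus unique, and the sequence is continued by \<open>0\<close>.\<close>

definition hilbert_coeff ::
    "('a, 'r) ring_scheme \<Rightarrow> 'a set \<Rightarrow> ('a, 'b, 'm) module_scheme \<Rightarrow> nat \<Rightarrow> int"
  where "hilbert_coeff R J M = (THE e. let d = the_enat (module_dim R M) in
    hilbert_poly R J M = (\<Sum>i\<le>d. Polynomial.smult ((-1) ^ i * of_int (e i)) (binomial_poly (d - i))) \<and>
    (\<forall>i>d. e i = 0))"

definition chern_number ::
    "('a, 'r) ring_scheme \<Rightarrow> 'a set \<Rightarrow> ('a, 'b, 'm) module_scheme \<Rightarrow> int"
  where "chern_number R J M = hilbert_coeff R J M 1"

end

theory Submission
  imports Defs "HOL-Library.List_Lexorder"
begin

text \<open>
  Write \<open>x\<^sub>1, \<dots>, x\<^sub>d\<close> for the parameters and fix a chain \<open>JM = M\<^sub>0 \<subset> \<dots> \<subset> M\<^sub>r = M\<close> with simple quotients.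
  Order the monomials in \<open>d\<close> variables by a local order (larger degree first) and refine
  \<open>J\<^sup>n\<^sup>+\<^sup>1M \<subseteq> M\<close> by the submodules \<open>U\<^sub>\<alpha>\<^sub>,\<^sub>i = (\<Sum>\<beta><\<alpha>. x\<^sup>\<beta>M) + x\<^sup>\<alpha>M\<^sub>i\<close>. Each quotient \<open>U\<^sub>\<alpha>\<^sub>,\<^sub>i\<^sub>+\<^sub>1 / U\<^sub>\<alpha>\<^sub>,\<^sub>i\<close> is an image
  of \<open>M\<^sub>i\<^sub>+\<^sub>1 / M\<^sub>i\<close>, hence simple or zero, and the set \<open>D\<^sub>i\<close> of those \<open>\<alpha>\<close> for which it is nonzero is a down-set
  of \<open>\<nat>\<^sup>d\<close>. So \<open>\<lambda>(M/J\<^sup>n\<^sup>+\<^sup>1M)\<close> is the number of pairs \<open>(i, \<alpha>)\<close> with \<open>i < r\<close>, \<open>\<alpha> \<in> D\<^sub>i\<close> and \<open>|\<alpha>| \<le> n\<close>. The full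
  down-set contributes exactly \<open>binom(n + d, d)\<close>, which has \<open>e\<^sub>1 = 0\<close>, and a proper one a polynomial of
  degree less than \<open>d\<close>, whose coefficient \<open>-e\<^sub>1\<close> of \<open>binom(n + d - 1, d - 1)\<close> is nonnegative.
\<close>

section \<open>Counting lattice points in down-sets\<close>

definition exponents :: "nat \<Rightarrow> nat list set"
  where "exponents d = {\<alpha>. length \<alpha> = d}"

definition down_set :: "nat \<Rightarrow> nat list set \<Rightarrow> bool"
  where "down_set d D \<longleftrightarrow>
    D \<subseteq> exponents d \<and> (\<forall>\<alpha>\<in>D. \<forall>\<beta>. list_all2 (\<le>) \<beta> \<alpha> \<longrightarrow> \<beta> \<in> D)"

definition slice :: "nat \<Rightarrow> nat list set \<Rightarrow> nat list set"
  where "slice k D = {\<alpha>. k # \<alpha> \<in> D}"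

definition count_upto :: "nat list set \<Rightarrow> nat \<Rightarrow> nat"
  where "count_upto D n = card {\<alpha> \<in> D. sum_list \<alpha> \<le> n}"

text \<open>\<open>m\<close> is the number of coefficients, so the degree is less than
  \<open>m\<close>. The basis \<open>binom(n + i, i)\<close> is the one in which the Hilbert
  coefficients are defined: for \<open>m = d + 1\<close> with \<open>d \<ge> 1\<close> the entry
  \<open>c (d - 1)\<close> plays the role of \<open>-e_1\<close>.\<close>

definition eventually_binomial :: "nat \<Rightarrow> (nat \<Rightarrow> int) \<Rightarrow> (nat \<Rightarrow> int) \<Rightarrow> bool"
  where "eventually_binomial m c h \<longleftrightarrow>
    (\<forall>\<^sub>F n in sequentially. h n = (\<Sum>i<m. c i * int ((n + i) choose i)))"

section \<open>Eventually polynomial functions in the binomial basis\<close>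

lemma eventually_binomial_sum:
  assumes "finite A" and "\<And>k. k \<in> A \<Longrightarrow> eventually_binomial m (c k) (h k)"
  shows "eventually_binomial m (\<lambda>i. \<Sum>k\<in>A. c k i) (\<lambda>n. \<Sum>k\<in>A. h k n)"
proof -
  have "\<forall>\<^sub>F n in sequentially. \<forall>k\<in>A. h k n = (\<Sum>i<m. c k i * int ((n + i) choose i))"
    using assms by (simp add: eventually_binomial_def eventually_ball_finite)
  then show ?thesis
    unfolding eventually_binomial_def
    by eventually_elim (simp add: sum_distrib_right sum.swap[of _ A])
qed

lemma eventually_binomial_pad:
  assumes "eventually_binomial m c h"
  shows "eventually_binomial (Suc m) (c(m := 0)) h"
  using assms unfolding eventually_binomial_def by eventually_elim simp

text \<open>Pascal's rule \<open>binom(n + i, i) = binom(n + 1 + i, i) - binom(n + i, i - 1)\<close>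
  expands the basis at \<open>n\<close> in the basis at \<open>n + 1\<close>, because
  \<open>n + i = (n + 1) + (i - 1)\<close>. Each coefficient loses its successor; the last one has
  none and stays.\<close>

lemma eventually_binomial_shift1:
  assumes "eventually_binomial m c h"
  shows "eventually_binomial m (\<lambda>i. c i - (if Suc i < m then c (Suc i) else 0)) (\<lambda>n. h (n - 1))"
proof -
  have *: "(\<Sum>i<m. c i * int ((n + i) choose i)) =
      (\<Sum>i<m. (c i - (if Suc i < m then c (Suc i) else 0)) * int ((Suc n + i) choose i))" for n
  proof (cases m)
    case (Suc l)
    have "(\<Sum>i<l. c (Suc i) * int ((n + Suc i) choose Suc i)) =
        (\<Sum>i<l. c (Suc i) * int ((Suc n + Suc i) choose Suc i)) -
        (\<Sum>i<l. c (Suc i) * int ((Suc n + i) choose i))"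
      by (simp add: sum_subtractf[symmetric] algebra_simps)
    then have "(\<Sum>i<m. c i * int ((n + i) choose i)) =
      (\<Sum>i<m. c i * int ((Suc n + i) choose i)) - (\<Sum>i<l. c (Suc i) * int ((Suc n + i) choose i))"
      unfolding Suc sum.lessThan_Suc_shift by simp
    also have "(\<Sum>i<l. c (Suc i) * int ((Suc n + i) choose i)) =
       (\<Sum>i<m. (if Suc i < m then c (Suc i) else 0) * int ((Suc n + i) choose i))"
      unfolding Suc sum.lessThan_Suc by simp
    finally show ?thesis
      by (simp add: sum_subtractf[symmetric] left_diff_distrib)
  qed simp
  have "\<forall>\<^sub>F n in sequentially. h (Suc n - 1) = 
      (\<Sum>i<m. (c i - (if Suc i < m then c (Suc i) else 0)) * int ((Suc n + i) choose i))"
    using assms unfolding eventually_binomial_def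
    by eventually_elim (use * in simp)
  then show ?thesis
    unfolding eventually_binomial_def
    by (subst (asm) eventually_sequentially_Suc[where P =
      "\<lambda>n. h (n - 1) = (\<Sum>i<m. (c i - (if Suc i < m then c (Suc i) else 0)) * int ((n + i) choose i))"])
qed

text \<open>Iterating the one-step shift never touches the top coefficient, the only one whose sign
  is tracked. Truncation of \<open>n - k\<close> is invisible for large \<open>n\<close>.\<close>

lemma eventually_binomial_shift:
  assumes "eventually_binomial m c h"
  shows "\<exists>c'. eventually_binomial m c' (\<lambda>n. h (n - k)) \<and> c' (m - 1) = c (m - 1)"
proof (induction k)
  case 0
  then show ?case using assms by auto
next
  case (Suc k)
  then obtain c' where c': "eventually_binomial m c' (\<lambda>n. h (n - k))" "c' (m - 1) = c (m - 1)"
    by blast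
  show ?case
    using eventually_binomial_shift1[OF c'(1)] c'(2) by (auto intro!: exI)
qed

text \<open>The hockey-stick identity, summing \<open>binom(j + i, i)\<close> over
  \<open>j \<le> n\<close> to \<open>binom(n + i + 1, i + 1)\<close>, moves every coefficient up one
  index, so \<open>c (m - 1)\<close> becomes the new top one. The finitely many exceptional values
  only change the constant.\<close>

lemma eventually_binomial_cumulative:
  assumes "eventually_binomial m c h" and "\<And>n. h n \<ge> 0" and "m > 0 \<Longrightarrow> c (m - 1) \<ge> 0"
  shows "\<exists>c'. eventually_binomial (Suc m) c' (\<lambda>n. \<Sum>j\<le>n. h j) \<and> c' m \<ge> 0"
proof -
  obtain N where N: "h n = (\<Sum>i<m. c i * int ((n + i) choose i))" if "n \<ge> N" for n
    using assms(1) unfolding eventually_binomial_def eventually_sequentially by blast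
  define g where "g n = (\<Sum>i<m. c i * int ((n + i) choose i))" for n
  define G where "G n = (\<Sum>i<m. c i * int ((n + Suc i) choose Suc i))" for n
  have G: "(\<Sum>j\<le>n. g j) = G n" for n
  proof (induction n)
    case (Suc n)
    have "G (Suc n) = G n + g (Suc n)"
      unfolding G_def g_def by (simp add: sum.distrib[symmetric] algebra_simps)
    with Suc show ?case by simp
  qed (simp add: G_def g_def)
  \<comment> \<open>The total error of the polynomial \<open>g\<close>, which agrees with
    \<open>h\<close> from \<open>N\<close> on.\<close>
  define c0 where "c0 = (\<Sum>j\<le>N. h j - g j)"
  have sumh: "(\<Sum>j\<le>n. h j) = c0 + G n" if "n \<ge> N" for n
  proof -
    have "(\<Sum>j\<le>n. h j - g j) = c0"
      unfolding c0_def using that by (intro sum.mono_neutral_right) (auto simp: N g_def)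
    then show ?thesis by (simp add: sum_subtractf G)
  qed
  let ?c = "\<lambda>i. case i of 0 \<Rightarrow> c0 | Suc j \<Rightarrow> c j"
  have "eventually_binomial (Suc m) ?c (\<lambda>n. \<Sum>j\<le>n. h j)"
    unfolding eventually_binomial_def
  proof (rule eventually_mono[OF eventually_ge_at_top[of N]])
    fix n assume "n \<ge> N"
    show "(\<Sum>j\<le>n. h j) = (\<Sum>i<Suc m. ?c i * int ((n + i) choose i))"
      unfolding sum.lessThan_Suc_shift using sumh[OF \<open>n \<ge> N\<close>] by (simp add: G_def)
  qed
  moreover have "?c m \<ge> 0"
  proof (cases m)
    \<comment> \<open>Without terms the polynomial vanishes and \<open>c0\<close>, now a sum of
      values of \<open>h\<close>, is itself the top coefficient.\<close>
    case 0
    then have "c0 = (\<Sum>j\<le>N. h j)" by (simp add: c0_def g_def)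
    then show ?thesis using 0 assms(2) by (simp add: sum_nonneg)
  qed (use assms(3) in auto)
  ultimately show ?thesis by blast
qed

section \<open>Down-sets: slices and stabilisation of decreasing sequences\<close>

lemma down_set_slice:
  assumes "down_set (Suc d) D"
  shows "down_set d (slice k D)"
  using assms unfolding down_set_def slice_def exponents_def by fastforce

lemma slice_antimono:
  assumes "down_set (Suc d) D" "j \<le> k"
  shows "slice k D \<subseteq> slice j D"
proof
  fix \<alpha> assume "\<alpha> \<in> slice k D"
  moreover have "list_all2 (\<le>) (j # \<alpha>) (k # \<alpha>)"
    using assms(2) by (simp add: list_all2_refl)
  ultimately show "\<alpha> \<in> slice j D"
    using assms(1) unfolding down_set_def slice_def by blast
qed

text \<open>Dickson's lemma seen from the complement: complements of down-sets are exponent sets of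
  monomial ideals, whose ascending chains stop. The induction on \<open>d\<close> first stabilises
  the diagonal slices, which controls all slices with large first entry, and then the finitely many
  remaining ones.\<close>

lemma decseq_down_sets_stabilise:
  fixes D :: "nat \<Rightarrow> nat list set"
  assumes "\<And>k. down_set d (D k)" and "antimono D"
  shows "\<exists>K. \<forall>k\<ge>K. D k = D K"
  using assms
proof (induction d arbitrary: D)
  case 0
  have *: "D k = {} \<or> D k = {[]}" for k
    using 0(1)[of k] unfolding down_set_def exponents_def by auto
  show ?case
  proof (cases "\<exists>K. D K = {}")
    case True
    then obtain K where "D K = {}" ..
    then have "\<forall>k\<ge>K. D k = D K" using antimonoD[OF 0(2)] by fastforce
    then show ?thesis ..
  qed (use * in metis)
next
  case (Suc d)
  have mono: "slice j (D k) \<subseteq> slice j' (D k')" if "j' \<le> j" "k' \<le> k" for j k j' k'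
    using slice_antimono[OF Suc.prems(1) that(1)] antimonoD[OF Suc.prems(2) that(2)]
    unfolding slice_def by blast
  \<comment> \<open>The diagonal decreases because a slice shrinks in its own index as well as in
    the index of the sequence.\<close>
  have "\<exists>K. \<forall>k\<ge>K. slice k (D k) = slice K (D K)"
    by (rule Suc.IH[OF down_set_slice[OF Suc.prems(1)]]) (rule antimonoI, rule mono)
  then obtain K where K: "\<And>k. k \<ge> K \<Longrightarrow> slice k (D k) = slice K (D K)" by blast
  have "\<exists>L. \<forall>k\<ge>L. slice j (D k) = slice j (D L)" for j
    by (rule Suc.IH[OF down_set_slice[OF Suc.prems(1)]]) (rule antimonoI, rule mono, simp)
  then obtain L where L: "\<And>j k. k \<ge> L j \<Longrightarrow> slice j (D k) = slice j (D (L j))" by metis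
  \<comment> \<open>Beyond \<open>N\<close> the diagonal is constant, and so is each slice with
    index below \<open>K\<close>.\<close>
  define N where "N = Max (insert K (L ` {..<K}))"
  have NL: "N \<ge> L j" if "j < K" for j
    using that by (auto simp: N_def)
  have "N \<ge> K" by (simp add: N_def)
  have "slice j (D k) = slice j (D N)" if "k \<ge> N" for j k
  proof (cases "j < K")
    case True
    then show ?thesis using L[of j k] L[of j N] NL[of j] that by simp
  next
    case False
    \<comment> \<open>A sandwich: the slice contains the diagonal slice at \<open>max j l\<close>,
      which is already equal to \<open>slice K (D K)\<close>.\<close>
    have *: "slice j (D l) = slice K (D K)" if "l \<ge> N" for l
    proof
      show "slice j (D l) \<subseteq> slice K (D K)" using mono False that \<open>N \<ge> K\<close> by simp
      show "slice K (D K) \<subseteq> slice j (D l)"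
        using mono[of j "max j l" l "max j l"] K[of "max j l"] False by simp
    qed
    show ?thesis using *[of k] *[of N] that by simp
  qed
  \<comment> \<open>A set of nonempty lists is determined by its slices.\<close>
  moreover have "D k = D l" if "\<And>j. slice j (D k) = slice j (D l)" for k l
  proof -
    have "[] \<notin> D i" for i using Suc.prems(1)[of i] by (auto simp: down_set_def exponents_def)
    then have "\<alpha> \<in> D k \<longleftrightarrow> \<alpha> \<in> D l" for \<alpha>
      using that[of "hd \<alpha>"] by (cases \<alpha>) (auto simp: slice_def)
    then show ?thesis by blast
  qed
  ultimately show ?case by blast
qed

section \<open>Lattice-point counts of full and proper down-sets\<close>

lemma finite_exponents_upto: "finite {\<alpha> \<in> exponents d. sum_list \<alpha> \<le> n}"
proof (rule finite_subset)
  show "{\<alpha> \<in> exponents d. sum_list \<alpha> \<le> n} \<subseteq> {\<alpha>. set \<alpha> \<subseteq> {..n} \<and> length \<alpha> = d}"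
    using member_le_sum_list by (fastforce simp: exponents_def)
qed (simp add: finite_lists_length_eq)

text \<open>Points are sorted by their first entry \<open>k\<close>, which leaves degree
  \<open>n - k\<close> for the other entries and cannot exceed \<open>n\<close>.\<close>

lemma count_upto_slices:
  assumes "D \<subseteq> exponents (Suc d)"
  shows "count_upto D n = (\<Sum>k\<le>n. count_upto (slice k D) (n - k))"
proof -
  let ?S = "\<lambda>k. {\<beta> \<in> slice k D. sum_list \<beta> \<le> n - k}"
  have fin: "finite (?S k)" for k
    by (rule finite_subset[OF _ finite_exponents_upto[of d "n - k"]])
       (use assms in \<open>auto simp: slice_def exponents_def\<close>)
  have "{\<alpha> \<in> D. sum_list \<alpha> \<le> n} = (\<Union>k\<le>n. (#) k ` ?S k)"
  proof (intro equalityI subsetI)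
    fix \<alpha> assume \<alpha>: "\<alpha> \<in> {\<alpha> \<in> D. sum_list \<alpha> \<le> n}"
    then obtain k \<beta> where "\<alpha> = k # \<beta>"
      using assms by (cases \<alpha>) (auto simp: exponents_def)
    then show "\<alpha> \<in> (\<Union>k\<le>n. (#) k ` ?S k)"
      using \<alpha> by (intro UN_I[of k] imageI) (auto simp: slice_def)
  qed (auto simp: slice_def)
  then have "count_upto D n = (\<Sum>k\<le>n. card ((#) k ` ?S k))"
    unfolding count_upto_def by (subst card_UN_disjoint[symmetric]) (auto simp: fin)
  also have "\<dots> = (\<Sum>k\<le>n. count_upto (slice k D) (n - k))"
    unfolding count_upto_def by (intro sum.cong refl card_image) simp
  finally show ?thesis .
qed

text \<open>All slices of the full set are full, so the induction step is the hockey-stick identity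
  with the order of summation reversed.\<close>

lemma count_upto_exponents: "count_upto (exponents d) n = (n + d) choose d"
proof (induction d arbitrary: n)
  case 0
  have "{\<alpha> \<in> exponents 0. sum_list \<alpha> \<le> n} = {[]}" by (auto simp: exponents_def)
  then show ?case by (simp add: count_upto_def)
next
  case (Suc d)
  have "slice k (exponents (Suc d)) = exponents d" for k by (auto simp: slice_def exponents_def)
  then have "count_upto (exponents (Suc d)) n = (\<Sum>k\<le>n. (n - k + d) choose d)"
    by (simp add: count_upto_slices[of _ d] Suc)
  also have "\<dots> = (\<Sum>k\<le>n. (d + k) choose d)"
    by (subst sum.nat_diff_reindex[symmetric, of _ "Suc n", unfolded lessThan_Suc_atMost])
       (auto intro!: sum.cong simp: add.commute)
  also have "\<dots> = (Suc d + n) choose Suc d"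
    using choose_rising_sum(1)[of d n] by simp
  finally show ?case by (simp only: add.commute)
qed

text \<open>From some index \<open>K\<close> on all slices coincide, and this common slice is
  proper. The slices from \<open>K\<close> on contribute its cumulative count at
  \<open>n - K\<close>, whose degree bound is one higher than that of the slice; the finitely many
  slices before \<open>K\<close> are counted in one dimension less. All these top coefficients are
  nonnegative.\<close>

lemma count_upto_proper_down_set:
  assumes "down_set d D" and "D \<noteq> exponents d"
  shows "\<exists>c. eventually_binomial d c (\<lambda>n. int (count_upto D n)) \<and> (d > 0 \<longrightarrow> c (d - 1) \<ge> 0)"
  using assms
proof (induction d arbitrary: D)
  case 0
  then have "D = {}" by (auto simp: down_set_def exponents_def)
  then show ?case by (simp add: count_upto_def eventually_binomial_def)
next
  case (Suc d)
  let ?h = "\<lambda>k n. int (count_upto (slice k D) n)"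
  have down: "down_set d (slice k D)" for k by (rule down_set_slice[OF Suc.prems(1)])
  have "\<exists>K. \<forall>k\<ge>K. slice k D = slice K D"
    by (rule decseq_down_sets_stabilise[OF down]) (rule antimonoI, rule slice_antimono[OF Suc.prems(1)])
  then obtain K where K: "\<And>k. k \<ge> K \<Longrightarrow> slice k D = slice K D" by blast
  \<comment> \<open>Slices decrease, so a full stable slice would make every slice full and
    \<open>D\<close> the whole of \<open>exponents (Suc d)\<close>.\<close>
  have "slice K D \<noteq> exponents d"
  proof
    assume *: "slice K D = exponents d"
    have "\<alpha> \<in> D" if "\<alpha> \<in> exponents (Suc d)" for \<alpha>
    proof -
      obtain k \<beta> where \<alpha>: "\<alpha> = k # \<beta>" "\<beta> \<in> exponents d"
        using \<open>\<alpha> \<in> exponents (Suc d)\<close> by (cases \<alpha>) (auto simp: exponents_def)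
      have "slice (max k K) D \<subseteq> slice k D" by (rule slice_antimono[OF Suc.prems(1)]) simp
      then show ?thesis using \<alpha> K[of "max k K"] * by (auto simp: slice_def)
    qed
    then show False using Suc.prems by (auto simp: down_set_def)
  qed
  then obtain cK where cK: "eventually_binomial d cK (?h K)" "d > 0 \<longrightarrow> cK (d - 1) \<ge> 0"
    using Suc.IH[OF down] by blast
  \<comment> \<open>Cumulating raises the number of coefficients from \<open>d\<close> to
    \<open>Suc d\<close>; the shift by \<open>K\<close> then accounts for the slices left out at the
    start.\<close>
  then obtain c1 where c1: "eventually_binomial (Suc d) c1 (\<lambda>n. \<Sum>j\<le>n. ?h K j)" "c1 d \<ge> 0"
    using eventually_binomial_cumulative[OF cK(1)] by auto
  then obtain c2 where c2:
      "eventually_binomial (Suc d) c2 (\<lambda>n. \<Sum>j\<le>n - K. ?h K j)" "c2 d \<ge> 0"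
    using eventually_binomial_shift[OF c1(1), of K] by auto
  have "\<exists>c. eventually_binomial (Suc d) c (\<lambda>n. ?h k (n - k)) \<and> c d \<ge> 0" for k
  proof -
    \<comment> \<open>The entry at \<open>d\<close> is 1 for a full slice and 0, by padding, for a
      proper one.\<close>
    have "\<exists>c. eventually_binomial (Suc d) c (?h k) \<and> c d \<ge> 0"
    proof (cases "slice k D = exponents d")
      case True
      have "eventually_binomial (Suc d) (\<lambda>i. if i = d then 1 else 0) (?h k)"
        by (simp add: eventually_binomial_def True count_upto_exponents)
      then show ?thesis by (intro exI conjI) auto
    next
      case False
      then obtain c where "eventually_binomial d c (?h k)" using Suc.IH[OF down] by blast
      then have "eventually_binomial (Suc d) (c(d := 0)) (?h k)" by (rule eventually_binomial_pad)
      then show ?thesis by (intro exI conjI) auto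
    qed
    then obtain c where c: "eventually_binomial (Suc d) c (?h k)" "c d \<ge> 0" by blast
    show ?thesis using eventually_binomial_shift[OF c(1), of k] c(2) by auto
  qed
  then obtain c3 where c3: "\<And>k. eventually_binomial (Suc d) (c3 k) (\<lambda>n. ?h k (n - k))"
      "\<And>k. c3 k d \<ge> 0"
    by metis
  let ?c = "\<lambda>i. (\<Sum>k<K. c3 k i) + c2 i"
  have count: "int (count_upto D n) = (\<Sum>k<K. ?h k (n - k)) + (\<Sum>j\<le>n - K. ?h K j)"
    if "n \<ge> K" for n
  proof -
    have "int (count_upto D n) = (\<Sum>k\<le>n. ?h k (n - k))"
      using Suc.prems(1) by (subst count_upto_slices[of _ d]) (auto simp: down_set_def)
    also have "{..n} = {..<K} \<union> {K..n}" using that by auto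
    also have "(\<Sum>k\<in>{..<K} \<union> {K..n}. ?h k (n - k)) =
        (\<Sum>k<K. ?h k (n - k)) + (\<Sum>k=K..n. ?h k (n - k))"
      by (rule sum.union_disjoint) auto
    also have "(\<Sum>k=K..n. ?h k (n - k)) = (\<Sum>k=K..n. ?h K (n - k))"
      by (rule sum.cong[OF refl], subst K) auto
    also have "\<dots> = (\<Sum>j\<le>n - K. ?h K j)"
      by (rule sum.reindex_bij_witness[of _ "\<lambda>j. n - j" "\<lambda>k. n - k"]) (use that in auto)
    finally show ?thesis .
  qed
  have "eventually_binomial (Suc d) (\<lambda>i. \<Sum>k<K. c3 k i) (\<lambda>n. \<Sum>k<K. ?h k (n - k))"
    by (rule eventually_binomial_sum) (use c3 in auto)
  with c2(1) have "eventually_binomial (Suc d) ?c (\<lambda>n. int (count_upto D n))"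
    unfolding eventually_binomial_def
    using eventually_ge_at_top[of K]
    by eventually_elim (simp add: count sum.distrib algebra_simps)
  moreover have "?c d \<ge> 0" using c2(2) c3(2) by (simp add: sum_nonneg)
  ultimately show ?case by (intro exI conjI) auto
qed

text \<open>The full set is counted by \<open>binom(n + d, d)\<close> alone, so its entry at
  \<open>d - 1\<close> is 0. For a proper set that entry is the tracked top coefficient, and a zero
  is appended at \<open>d\<close>.\<close>

lemma count_upto_down_set:
  assumes "down_set d D" and "d > 0"
  shows "\<exists>c. eventually_binomial (Suc d) c (\<lambda>n. int (count_upto D n)) \<and> c (d - 1) \<ge> 0"
proof (cases "D = exponents d")
  case True
  have "eventually_binomial (Suc d) (\<lambda>i. if i = d then 1 else 0) (\<lambda>n. int (count_upto D n))"
    by (simp add: eventually_binomial_def True count_upto_exponents)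
  then show ?thesis by (intro exI conjI) auto
next
  case False
  then obtain c where "eventually_binomial d c (\<lambda>n. int (count_upto D n))" "c (d - 1) \<ge> 0"
    using count_upto_proper_down_set[OF assms(1)] assms(2) by blast
  then have "eventually_binomial (Suc d) (c(d := 0)) (\<lambda>n. int (count_upto D n))"
    "(c(d := 0)) (d - 1) \<ge> 0"
    using eventually_binomial_pad assms(2) by auto
  then show ?thesis by blast
qed

section \<open>Submodules and composition series\<close>

context module
begin

lemma submodule_carrier: "submodule H R M \<Longrightarrow> x \<in> H \<Longrightarrow> x \<in> carrier M"
  using submoduleE(1) by blast

lemma submodule_zero: "submodule H R M \<Longrightarrow> \<zero>\<^bsub>M\<^esub> \<in> H"
  using subgroup.one_closed submodule.axioms(1) by fastforce

lemma submodule_minus: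
  "submodule H R M \<Longrightarrow> x \<in> H \<Longrightarrow> y \<in> H \<Longrightarrow> x \<ominus>\<^bsub>M\<^esub> y \<in> H"
  by (simp add: a_minus_def submoduleE(3) submoduleE(5))

lemma submodule_add_cancel:
  assumes "submodule H R M" "x \<in> carrier M" "y \<in> H" "x \<ominus>\<^bsub>M\<^esub> y \<in> H"
  shows "x \<in> H"
proof -
  have "y \<in> carrier M" using assms submodule_carrier by blast
  then have "x = (x \<ominus>\<^bsub>M\<^esub> y) \<oplus>\<^bsub>M\<^esub> y"
    using assms(2) by (simp add: a_minus_def M.a_assoc M.l_neg)
  then show ?thesis using submoduleE(5)[OF assms(1,4,3)] by simp
qed

lemma submodule_Int:
  assumes "submodule H R M" "submodule K R M"
  shows "submodule (H \<inter> K) R M"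
  using assms by (intro submoduleI) (auto simp: submodule_carrier submodule_zero submoduleE)

lemma submodule_span_superset: "S \<subseteq> submodule_span R M S"
  unfolding submodule_span_def by blast

lemma submodule_span_minimal:
  "submodule N R M \<Longrightarrow> S \<subseteq> N \<Longrightarrow> submodule_span R M S \<subseteq> N"
  unfolding submodule_span_def by blast

lemma submodule_span_is_submodule:
  assumes "S \<subseteq> carrier M"
  shows "submodule (submodule_span R M S) R M"
proof (rule submoduleI)
  show "submodule_span R M S \<subseteq> carrier M"
    by (rule submodule_span_minimal[OF carrier_is_submodule assms])
qed (auto simp: submodule_span_def submodule_zero submoduleE)

text \<open>The colon module of \<open>N\<close> by \<open>a\<close> inside \<open>M\<close>; it
  reduces the multiplication of a span by \<open>a\<close> to the generators.\<close>

lemma submodule_colon: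
  assumes "submodule N R M" "a \<in> carrier R"
  shows "submodule {y \<in> carrier M. a \<odot>\<^bsub>M\<^esub> y \<in> N} R M"
proof (rule submoduleI)
  fix b y assume "b \<in> carrier R" "y \<in> {y \<in> carrier M. a \<odot>\<^bsub>M\<^esub> y \<in> N}"
  moreover from this have "a \<odot>\<^bsub>M\<^esub> (b \<odot>\<^bsub>M\<^esub> y) = b \<odot>\<^bsub>M\<^esub> (a \<odot>\<^bsub>M\<^esub> y)"
    using assms(2) by (simp add: smult_assoc1[symmetric] R.m_comm)
  ultimately show "b \<odot>\<^bsub>M\<^esub> y \<in> {y \<in> carrier M. a \<odot>\<^bsub>M\<^esub> y \<in> N}"
    using assms(1) by (simp add: submoduleE)
qed (use assms in \<open>auto simp: submodule_zero submoduleE smult_r_minus smult_r_distr\<close>)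

lemma smult_span_closed:
  assumes "submodule N R M" "a \<in> carrier R" "S \<subseteq> carrier M"
    and "\<And>s. s \<in> S \<Longrightarrow> a \<odot>\<^bsub>M\<^esub> s \<in> N" and "y \<in> submodule_span R M S"
  shows "a \<odot>\<^bsub>M\<^esub> y \<in> N"
proof -
  have "submodule_span R M S \<subseteq> {y \<in> carrier M. a \<odot>\<^bsub>M\<^esub> y \<in> N}"
    using assms(3,4) by (intro submodule_span_minimal submodule_colon assms(1,2)) auto
  then show ?thesis using assms(5) by blast
qed

text \<open>Because the transporter of \<open>S\<close> into \<open>N\<close> is an ideal, the
  inclusion \<open>JS \<subseteq> N\<close> need only be checked on generators of
  \<open>J\<close>.\<close>

lemma ideal_transporter:
  assumes "submodule N R M" "S \<subseteq> carrier M"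
  shows "ideal {a \<in> carrier R. \<forall>s\<in>S. a \<odot>\<^bsub>M\<^esub> s \<in> N} R"
proof (rule idealI[OF R.ring_axioms])
  show "subgroup {a \<in> carrier R. \<forall>s\<in>S. a \<odot>\<^bsub>M\<^esub> s \<in> N} (add_monoid R)"
  proof (rule R.add.subgroupI)
    show "{a \<in> carrier R. \<forall>s\<in>S. a \<odot>\<^bsub>M\<^esub> s \<in> N} \<noteq> {}"
      using assms by (auto intro!: exI[of _ "\<zero>"] simp: submodule_zero subset_iff)
  qed (use assms in \<open>auto simp: smult_l_minus smult_l_distr submoduleE subset_iff\<close>)
next
  fix a x assume a: "a \<in> {a \<in> carrier R. \<forall>s\<in>S. a \<odot>\<^bsub>M\<^esub> s \<in> N}" and x: "x \<in> carrier R"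
  then show "x \<otimes> a \<in> {a \<in> carrier R. \<forall>s\<in>S. a \<odot>\<^bsub>M\<^esub> s \<in> N}"
    using assms by (auto simp: smult_assoc1 submoduleE subset_iff)
  then show "a \<otimes> x \<in> {a \<in> carrier R. \<forall>s\<in>S. a \<odot>\<^bsub>M\<^esub> s \<in> N}"
    using a x by (simp add: R.m_comm)
qed

end

definition simple_step :: "('a, 'r) ring_scheme \<Rightarrow> ('a, 'b, 'm) module_scheme \<Rightarrow> 'b set \<Rightarrow> 'b set \<Rightarrow> bool"
  where "simple_step R M B C \<longleftrightarrow> submodule B R M \<and> submodule C R M \<and> B \<subseteq> C \<and>
    (\<forall>w\<in>C - B. \<forall>y\<in>C. \<exists>r\<in>carrier R. y \<ominus>\<^bsub>M\<^esub> r \<odot>\<^bsub>M\<^esub> w \<in> B)"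

inductive composition_series ::
    "('a, 'r) ring_scheme \<Rightarrow> ('a, 'b, 'm) module_scheme \<Rightarrow> 'b set \<Rightarrow> nat \<Rightarrow> 'b set \<Rightarrow> bool"
  for R M A where
  base: "submodule A R M \<Longrightarrow> composition_series R M A 0 A"
| step: "composition_series R M A k B \<Longrightarrow> simple_step R M B C \<Longrightarrow> B \<noteq> C \<Longrightarrow>
    composition_series R M A (Suc k) C"

text \<open>The lowest term may be larger than \<open>A\<close>. Recursion at the top suits the
  inductions; \<open>strict_chain_terms\<close> and \<open>strict_chainI\<close> translate to the
  indexed families in \<open>module_length\<close>.\<close>

primrec strict_chain ::
    "('a, 'r) ring_scheme \<Rightarrow> ('a, 'b, 'm) module_scheme \<Rightarrow> 'b set \<Rightarrow> nat \<Rightarrow> 'b set \<Rightarrow> bool"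
  where
  "strict_chain R M A 0 B \<longleftrightarrow> submodule B R M \<and> A \<subseteq> B"
| "strict_chain R M A (Suc n) B \<longleftrightarrow> submodule B R M \<and> (\<exists>C. strict_chain R M A n C \<and> C \<subset> B)"

lemma strict_chain_submodule: "strict_chain R M A n B \<Longrightarrow> submodule B R M"
  by (cases n) auto

lemma strict_chain_superset: "strict_chain R M A n B \<Longrightarrow> A \<subseteq> B"
  by (induction n arbitrary: B) (simp, fastforce)

lemma strict_chain_terms:
  assumes "strict_chain R M A n B"
  shows "\<exists>N. (\<forall>i\<le>n. submodule (N i) R M \<and> A \<subseteq> N i) \<and> (\<forall>i<n. N i \<subset> N (Suc i)) \<and> N n = B"
  using assms
proof (induction n arbitrary: B)
  case 0
  then show ?case by (intro exI[of _ "\<lambda>_. B"]) auto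
next
  case (Suc n)
  then obtain C where C: "strict_chain R M A n C" "C \<subset> B" "submodule B R M" by auto
  from Suc.IH[OF C(1)] obtain N where
    N: "(\<forall>i\<le>n. submodule (N i) R M \<and> A \<subseteq> N i) \<and> (\<forall>i<n. N i \<subset> N (Suc i)) \<and> N n = C"
    by (rule exE)
  have "A \<subseteq> B" using strict_chain_superset[OF Suc.prems] .
  show ?case
    by (rule exI[of _ "N(Suc n := B)"]) (use N C \<open>A \<subseteq> B\<close> in \<open>simp add: le_Suc_eq less_Suc_eq\<close>)
qed

lemma strict_chainI:
  assumes "\<And>i. i \<le> n \<Longrightarrow> submodule (N i) R M" "\<And>i. i \<le> n \<Longrightarrow> A \<subseteq> N i"
    and "\<And>i. i < n \<Longrightarrow> N i \<subset> N (Suc i)"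
  shows "strict_chain R M A n (N n)"
  using assms
proof (induction n)
  case (Suc n)
  then have "strict_chain R M A n (N n)" "N n \<subset> N (Suc n)" "submodule (N (Suc n)) R M"
    by simp_all
  then show ?case by (simp only: strict_chain.simps) blast
qed simp

lemma composition_series_submodules:
  assumes "composition_series R M A k B"
  shows "submodule A R M" and "submodule B R M" and "A \<subseteq> B"
  using assms by (induction rule: composition_series.induct) (auto simp: simple_step_def)

lemma composition_series_strict_chain:
  "composition_series R M A k B \<Longrightarrow> strict_chain R M A k B"
  by (induction rule: composition_series.induct) (auto simp: simple_step_def intro: psubsetI)

lemma composition_series_weak_step:
  assumes "composition_series R M A k B" "simple_step R M B C"
  shows "composition_series R M A (k + of_bool (B \<noteq> C)) C"
  using assms composition_series.step[OF assms] by (cases "B = C") auto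

lemma composition_series_terms:
  assumes "composition_series R M A k B"
  shows "\<exists>N. N 0 = A \<and> N k = B \<and> (\<forall>i<k. simple_step R M (N i) (N (Suc i)))"
  using assms
proof induction
  case base
  show ?case by (intro exI[of _ "\<lambda>_. A"]) simp
next
  case (step k B C)
  then obtain N where "N 0 = A" "N k = B" "\<forall>i<k. simple_step R M (N i) (N (Suc i))" by blast
  then show ?case
    by (intro exI[of _ "N(Suc k := C)"]) (use step in \<open>auto simp: less_Suc_eq\<close>)
qed

section \<open>Composition series bound all chains\<close>

context module
begin

text \<open>A certificate that chains of submodules between \<open>A\<close> and \<open>B\<close>
  have at most \<open>k\<close> strict inclusions. It takes the place of a Jordan-Hoelder
  refinement.\<close>

definition rank_function :: "'c set \<Rightarrow> 'c set \<Rightarrow> nat \<Rightarrow> ('c set \<Rightarrow> nat) \<Rightarrow> bool"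
  where "rank_function A B k f \<longleftrightarrow> (\<forall>W. submodule W R M \<longrightarrow> W \<subseteq> B \<longrightarrow> f W \<le> k) \<and>
    (\<forall>W W'. submodule W R M \<longrightarrow> submodule W' R M \<longrightarrow> A \<subseteq> W \<longrightarrow> W \<subset> W' \<longrightarrow> W' \<subseteq> B \<longrightarrow> f W < f W')"

text \<open>The function built here counts, for \<open>W\<close> below the top, the steps of the
  series at which the intersection with \<open>W\<close> grows.\<close>

lemma composition_series_rank:
  assumes "composition_series R M A k B"
  shows "\<exists>f. rank_function A B k f"
  using assms
proof induction
  case base
  have "rank_function A A 0 (\<lambda>_. 0)"
    unfolding rank_function_def by (intro conjI allI impI) (simp, blast)
  then show ?case by (rule exI[of "rank_function A A 0"])
next
  case (step k B C)
  from step.IH obtain f where rf: "rank_function A B k f" ..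
  note f = rf[unfolded rank_function_def, THEN conjunct1, rule_format]
    rf[unfolded rank_function_def, THEN conjunct2, rule_format]
  have B: "submodule B R M" "A \<subseteq> B" using composition_series_submodules[OF step.hyps(1)] by auto
  have simple: "\<exists>r\<in>carrier R. y \<ominus>\<^bsub>M\<^esub> r \<odot>\<^bsub>M\<^esub> w \<in> B" if "w \<in> C" "w \<notin> B" "y \<in> C" for w y
    using step.hyps(2) that unfolding simple_step_def by (simp add: Ball_def)
  define g :: "'c set \<Rightarrow> nat" where "g W = f (W \<inter> B) + of_bool (\<not> W \<subseteq> B)" for W
  have g_le: "g W \<le> Suc k" if "submodule W R M" for W
    using f(1)[OF submodule_Int[OF that B(1)]] unfolding g_def by auto
  have g_less: "g W < g W'"
    if W: "submodule W R M" "submodule W' R M" "A \<subseteq> W" "W \<subset> W'" "W' \<subseteq> C" for W W'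
  proof (cases "W \<inter> B = W' \<inter> B")
    case True
    \<comment> \<open>Otherwise some \<open>w\<close> in \<open>W\<close> generates \<open>C\<close>
      modulo \<open>B\<close>. Every \<open>y\<close> in \<open>W'\<close> is then a multiple of
      \<open>w\<close> plus an element of \<open>W' \<inter> B = W \<inter> B\<close>, which forces
      \<open>W' = W\<close>.\<close>
    have "W \<subseteq> B"
    proof (rule ccontr)
      assume "\<not> W \<subseteq> B"
      then obtain w where w: "w \<in> W" "w \<notin> B" by blast
      have "y \<in> W" if "y \<in> W'" for y
      proof -
        have "w \<in> C" "y \<in> C" using w(1) W(4,5) that by (simp_all add: psubset_eq subset_iff)
        then obtain r where r: "r \<in> carrier R" "y \<ominus>\<^bsub>M\<^esub> r \<odot>\<^bsub>M\<^esub> w \<in> B"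
          using simple w(2) by meson
        have "r \<odot>\<^bsub>M\<^esub> w \<in> W" using submoduleE(4)[OF W(1) r(1) w(1)] .
        moreover from this have "r \<odot>\<^bsub>M\<^esub> w \<in> W'" using W(4) by (simp add: psubset_eq subset_iff)
        then have "y \<ominus>\<^bsub>M\<^esub> r \<odot>\<^bsub>M\<^esub> w \<in> W' \<inter> B"
          by (intro IntI submodule_minus[OF W(2) that] r(2))
        then have "y \<ominus>\<^bsub>M\<^esub> r \<odot>\<^bsub>M\<^esub> w \<in> W" unfolding True[symmetric] by (rule IntD1)
        ultimately show ?thesis
          by (intro submodule_add_cancel[OF W(1) submodule_carrier[OF W(2) that]])
      qed
      then have "W' \<subseteq> W" ..
      then show False using W(4) by (simp add: psubset_eq)
    qed
    moreover have "\<not> W' \<subseteq> B" using True W(4) calculation by (metis Int_absorb2 psubset_eq)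
    ultimately show ?thesis unfolding g_def True by simp
  next
    case False
    then have "f (W \<inter> B) < f (W' \<inter> B)"
      using W(3-5) by (intro f(2) submodule_Int W(1,2) B(1)) (auto intro: B(2)[THEN subsetD])
    moreover have "of_bool (\<not> W \<subseteq> B) \<le> (of_bool (\<not> W' \<subseteq> B) :: nat)" using W(4) by auto
    ultimately show ?thesis unfolding g_def by linarith
  qed
  have "rank_function A C (Suc k) g" by (simp add: rank_function_def g_le g_less)
  then show ?case by (rule exI[of "rank_function A C (Suc k)"])
qed

text \<open>Each strict inclusion raises the rank by at least one. As a series is itself a chain,
  its length is the maximal length of a chain.\<close>

lemma strict_chain_le_composition_series:
  assumes "composition_series R M A k B" "strict_chain R M A n W" "W \<subseteq> B"
  shows "n \<le> k"
proof -
  obtain f where rf: "rank_function A B k f"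
    using composition_series_rank[OF assms(1)] ..
  note f = rf[unfolded rank_function_def, THEN conjunct1, rule_format]
    rf[unfolded rank_function_def, THEN conjunct2, rule_format]
  have "n \<le> f W" using assms(2,3)
  proof (induction n arbitrary: W)
    case (Suc n)
    then obtain C where C: "strict_chain R M A n C" "C \<subset> W" "submodule W R M" by auto
    then have "n \<le> f C" using Suc.IH[of C] Suc.prems(2) by blast
    moreover have "f C < f W"
      using f(2) C strict_chain_submodule[OF C(1)] strict_chain_superset[OF C(1)] Suc.prems(2) by blast
    ultimately show ?case by simp
  qed simp
  then show ?thesis using f(1)[of W] strict_chain_submodule[OF assms(2)] assms(3) by simp
qed

section \<open>The submodules \<open>L + aN\<close>\<close>

definition add_multiples :: "'a \<Rightarrow> 'c set \<Rightarrow> 'c set \<Rightarrow> 'c set"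
  where "add_multiples a L N = {u \<oplus>\<^bsub>M\<^esub> a \<odot>\<^bsub>M\<^esub> y | u y. u \<in> L \<and> y \<in> N}"

lemma add_multiples_mono: "N \<subseteq> N' \<Longrightarrow> add_multiples a L N \<subseteq> add_multiples a L N'"
  unfolding add_multiples_def by blast

lemma add_multiplesI: "u \<in> L \<Longrightarrow> y \<in> N \<Longrightarrow> u \<oplus>\<^bsub>M\<^esub> a \<odot>\<^bsub>M\<^esub> y \<in> add_multiples a L N"
  unfolding add_multiples_def by blast

lemma submodule_add_multiples:
  assumes L: "submodule L R M" and N: "submodule N R M" and a: "a \<in> carrier R"
  shows "submodule (add_multiples a L N) R M"
proof (rule submoduleI)
  note car = submodule_carrier[OF L] submodule_carrier[OF N]
  show "add_multiples a L N \<subseteq> carrier M" using a car by (auto simp: add_multiples_def)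
  show "\<zero>\<^bsub>M\<^esub> \<in> add_multiples a L N"
    using add_multiplesI[OF submodule_zero[OF L] submodule_zero[OF N], of a] a by simp
  {
    fix x assume "x \<in> add_multiples a L N"
    then obtain u y where x: "x = u \<oplus>\<^bsub>M\<^esub> a \<odot>\<^bsub>M\<^esub> y" "u \<in> L" "y \<in> N" by (auto simp: add_multiples_def)
    then have "\<ominus>\<^bsub>M\<^esub> x = \<ominus>\<^bsub>M\<^esub> u \<oplus>\<^bsub>M\<^esub> a \<odot>\<^bsub>M\<^esub> (\<ominus>\<^bsub>M\<^esub> y)"
      using a car by (simp add: M.minus_add smult_r_minus)
    then show "\<ominus>\<^bsub>M\<^esub> x \<in> add_multiples a L N"
      using add_multiplesI[of "\<ominus>\<^bsub>M\<^esub> u" L "\<ominus>\<^bsub>M\<^esub> y" N a] x L N by (simp add: submoduleE)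
    {
      fix x' assume "x' \<in> add_multiples a L N"
      then obtain u' y' where x': "x' = u' \<oplus>\<^bsub>M\<^esub> a \<odot>\<^bsub>M\<^esub> y'" "u' \<in> L" "y' \<in> N"
        by (auto simp: add_multiples_def)
      then have "x \<oplus>\<^bsub>M\<^esub> x' = (u \<oplus>\<^bsub>M\<^esub> u') \<oplus>\<^bsub>M\<^esub> a \<odot>\<^bsub>M\<^esub> (y \<oplus>\<^bsub>M\<^esub> y')"
        using a car x by (simp add: smult_r_distr M.a_ac)
      then show "x \<oplus>\<^bsub>M\<^esub> x' \<in> add_multiples a L N"
        using add_multiplesI[of "u \<oplus>\<^bsub>M\<^esub> u'" L "y \<oplus>\<^bsub>M\<^esub> y'" N a] x x' L N by (simp add: submoduleE)
    }
    fix b assume b: "b \<in> carrier R"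
    have "b \<odot>\<^bsub>M\<^esub> (a \<odot>\<^bsub>M\<^esub> y) = a \<odot>\<^bsub>M\<^esub> (b \<odot>\<^bsub>M\<^esub> y)"
      using a b car x by (simp add: smult_assoc1[symmetric] R.m_comm)
    then have "b \<odot>\<^bsub>M\<^esub> x = b \<odot>\<^bsub>M\<^esub> u \<oplus>\<^bsub>M\<^esub> a \<odot>\<^bsub>M\<^esub> (b \<odot>\<^bsub>M\<^esub> y)"
      using a b car x by (simp add: smult_r_distr)
    then show "b \<odot>\<^bsub>M\<^esub> x \<in> add_multiples a L N"
      using add_multiplesI[of "b \<odot>\<^bsub>M\<^esub> u" L "b \<odot>\<^bsub>M\<^esub> y" N a] x b L N by (simp add: submoduleE)
  }
qed

lemma add_multiples_superset:
  assumes "submodule L R M" "submodule N R M" "a \<in> carrier R"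
  shows "L \<subseteq> add_multiples a L N"
proof
  fix u assume "u \<in> L"
  then have "u \<oplus>\<^bsub>M\<^esub> a \<odot>\<^bsub>M\<^esub> \<zero>\<^bsub>M\<^esub> \<in> add_multiples a L N"
    by (intro add_multiplesI submodule_zero assms)
  then show "u \<in> add_multiples a L N"
    using assms \<open>u \<in> L\<close> submodule_carrier[OF assms(1)] by simp
qed

lemma smult_in_add_multiples:
  assumes "submodule L R M" "submodule N R M" "a \<in> carrier R" "y \<in> N"
  shows "a \<odot>\<^bsub>M\<^esub> y \<in> add_multiples a L N"
  using add_multiplesI[OF submodule_zero[OF assms(1)] assms(4), of a] assms submodule_carrier[OF assms(2)]
  by simp

lemma add_multiples_minimal:
  assumes "submodule K R M" "L \<subseteq> K" "\<And>y. y \<in> N \<Longrightarrow> a \<odot>\<^bsub>M\<^esub> y \<in> K"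
  shows "add_multiples a L N \<subseteq> K"
  using assms by (auto simp: add_multiples_def submoduleE subset_iff)

text \<open>Multiplication by \<open>a\<close> maps \<open>N'/N\<close> onto
  \<open>(L + aN')/(L + aN)\<close>, and an image of a simple module is simple or zero.\<close>

lemma simple_step_add_multiples:
  assumes L: "submodule L R M" and step: "simple_step R M N N'" and a: "a \<in> carrier R"
  shows "simple_step R M (add_multiples a L N) (add_multiples a L N')"
  unfolding simple_step_def
proof (intro conjI ballI)
  have N: "submodule N R M" and N': "submodule N' R M" and "N \<subseteq> N'"
    using step by (auto simp: simple_step_def)
  show "submodule (add_multiples a L N) R M" "submodule (add_multiples a L N') R M"
    by (intro submodule_add_multiples L N N' a)+
  show "add_multiples a L N \<subseteq> add_multiples a L N'" by (rule add_multiples_mono[OF \<open>N \<subseteq> N'\<close>])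
  fix w x assume "w \<in> add_multiples a L N' - add_multiples a L N" and "x \<in> add_multiples a L N'"
  then obtain u y v z where w: "w = u \<oplus>\<^bsub>M\<^esub> a \<odot>\<^bsub>M\<^esub> y" "u \<in> L" "y \<in> N'" "y \<notin> N"
    and x: "x = v \<oplus>\<^bsub>M\<^esub> a \<odot>\<^bsub>M\<^esub> z" "v \<in> L" "z \<in> N'"
    by (auto simp: add_multiples_def)
  \<comment> \<open>As \<open>w\<close> is outside \<open>L + aN\<close>, its \<open>y\<close> is
    outside \<open>N\<close>. The scalar that works for \<open>y\<close> and \<open>z\<close> also
    works for \<open>w\<close> and \<open>x\<close>, since the remaining parts stay in
    \<open>L\<close>.\<close>
  then obtain r where r: "r \<in> carrier R" "z \<ominus>\<^bsub>M\<^esub> r \<odot>\<^bsub>M\<^esub> y \<in> N"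
    using step unfolding simple_step_def by blast
  have car: "u \<in> carrier M" "v \<in> carrier M" "y \<in> carrier M" "z \<in> carrier M"
    using w x submodule_carrier[OF L] submodule_carrier[OF N'] by auto
  have "r \<odot>\<^bsub>M\<^esub> (a \<odot>\<^bsub>M\<^esub> y) = a \<odot>\<^bsub>M\<^esub> (r \<odot>\<^bsub>M\<^esub> y)"
    using a r car by (simp add: smult_assoc1[symmetric] R.m_comm)
  then have "x \<ominus>\<^bsub>M\<^esub> r \<odot>\<^bsub>M\<^esub> w = (v \<ominus>\<^bsub>M\<^esub> r \<odot>\<^bsub>M\<^esub> u) \<oplus>\<^bsub>M\<^esub> a \<odot>\<^bsub>M\<^esub> (z \<ominus>\<^bsub>M\<^esub> r \<odot>\<^bsub>M\<^esub> y)"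
    using a r car unfolding w x
    by (simp add: smult_r_distr smult_r_minus a_minus_def M.minus_add M.a_ac)
  moreover have "v \<ominus>\<^bsub>M\<^esub> r \<odot>\<^bsub>M\<^esub> u \<in> L" using L r w x by (simp add: submodule_minus submoduleE)
  ultimately show "\<exists>r\<in>carrier R. x \<ominus>\<^bsub>M\<^esub> r \<odot>\<^bsub>M\<^esub> w \<in> add_multiples a L N"
    using add_multiplesI r by metis
qed

text \<open>Bounded chain lengths provide a longest chain with top \<open>B\<close>. Nothing fits
  strictly between its penultimate term \<open>C\<close> and \<open>B\<close>, so this step is
  simple, and \<open>C\<close> has a smaller bound.\<close>

lemma composition_series_exists:
  assumes "submodule A R M" "submodule B R M" "A \<subseteq> B"
    and "\<And>n. strict_chain R M A n B \<Longrightarrow> n \<le> b"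
  shows "\<exists>k. composition_series R M A k B"
  using assms
proof (induction b arbitrary: B rule: less_induct)
  case (less b)
  show ?case
  proof (cases "A = B")
    case True
    then show ?thesis using composition_series.base[of A R M] less.prems(1) by blast
  next
    case False
    have bound: "finite {n. strict_chain R M A n B}"
      by (rule finite_subset[of _ "{..b}"]) (use less.prems in auto)
    have "strict_chain R M A 1 B" using less.prems False by auto
    define m where "m = Max {n. strict_chain R M A n B}"
    have max: "n \<le> m" if "strict_chain R M A n B" for n
      unfolding m_def by (rule Max_ge[OF bound]) (simp add: that)
    have "m \<in> {n. strict_chain R M A n B}"
      unfolding m_def by (rule Max_in[OF bound]) (use \<open>strict_chain R M A 1 B\<close> in blast)
    then have m: "strict_chain R M A m B" ..
    obtain l where l: "m = Suc l"
      using max[OF \<open>strict_chain R M A 1 B\<close>] by (cases m) auto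
    with m obtain C where C: "strict_chain R M A l C" "C \<subset> B" by auto
    note subC = strict_chain_submodule[OF C(1)]
    \<comment> \<open>Appending \<open>B\<close> lengthens a chain ending in \<open>C\<close> by
      one.\<close>
    have "n \<le> l" if "strict_chain R M A n C" for n
      using max[of "Suc n"] that C less.prems(2) l by auto
    moreover have "l < b" using less.prems(4)[OF m] l by simp
    ultimately obtain k where k: "composition_series R M A k C"
      using less.IH[of l C] subC strict_chain_superset[OF C(1)] less.prems(1) by blast
    have "simple_step R M C B"
      unfolding simple_step_def
    proof (intro conjI ballI)
      fix w y assume w: "w \<in> B - C" and y: "y \<in> B"
      have wc: "w \<in> carrier M" using w submodule_carrier[OF less.prems(2)] by blast
      \<comment> \<open>This is \<open>C + Rw\<close>, strictly larger than \<open>C\<close>. Were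
        it smaller than \<open>B\<close>, inserting it would lengthen a longest chain.\<close>
      let ?E = "{u \<oplus>\<^bsub>M\<^esub> r \<odot>\<^bsub>M\<^esub> w | u r. u \<in> C \<and> r \<in> carrier R}"
      have "submodule ?E R M"
      proof (rule submoduleI)
        note car = submodule_carrier[OF subC]
        show "?E \<subseteq> carrier M" using wc car by auto
        have "\<zero>\<^bsub>M\<^esub> = \<zero>\<^bsub>M\<^esub> \<oplus>\<^bsub>M\<^esub> \<zero> \<odot>\<^bsub>M\<^esub> w" using wc by simp
        then show "\<zero>\<^bsub>M\<^esub> \<in> ?E" using submodule_zero[OF subC] by blast
        fix x assume "x \<in> ?E"
        then obtain u r where x: "x = u \<oplus>\<^bsub>M\<^esub> r \<odot>\<^bsub>M\<^esub> w" "u \<in> C" "r \<in> carrier R" by blast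
        have "\<ominus>\<^bsub>M\<^esub> x = \<ominus>\<^bsub>M\<^esub> u \<oplus>\<^bsub>M\<^esub> (\<ominus> r) \<odot>\<^bsub>M\<^esub> w"
          using x wc car by (simp add: M.minus_add smult_l_minus)
        then show "\<ominus>\<^bsub>M\<^esub> x \<in> ?E" using x submoduleE(3)[OF subC] by blast
        {
          fix x' assume "x' \<in> ?E"
          then obtain u' r' where x': "x' = u' \<oplus>\<^bsub>M\<^esub> r' \<odot>\<^bsub>M\<^esub> w" "u' \<in> C" "r' \<in> carrier R" by blast
          have "x \<oplus>\<^bsub>M\<^esub> x' = (u \<oplus>\<^bsub>M\<^esub> u') \<oplus>\<^bsub>M\<^esub> (r \<oplus> r') \<odot>\<^bsub>M\<^esub> w"
            using x x' wc car by (simp add: smult_l_distr M.a_ac)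
          then show "x \<oplus>\<^bsub>M\<^esub> x' \<in> ?E" using x x' submoduleE(5)[OF subC] by blast
        }
        fix b assume b: "b \<in> carrier R"
        have "b \<odot>\<^bsub>M\<^esub> x = b \<odot>\<^bsub>M\<^esub> u \<oplus>\<^bsub>M\<^esub> (b \<otimes> r) \<odot>\<^bsub>M\<^esub> w"
          using x b wc car by (simp add: smult_r_distr smult_assoc1)
        then show "b \<odot>\<^bsub>M\<^esub> x \<in> ?E" using x b submoduleE(4)[OF subC] by blast
      qed
      moreover have "C \<subset> ?E"
      proof
        show "C \<subseteq> ?E"
        proof
          fix u assume "u \<in> C"
          then have "u = u \<oplus>\<^bsub>M\<^esub> \<zero> \<odot>\<^bsub>M\<^esub> w" using wc submodule_carrier[OF subC] by simp
          then show "u \<in> ?E" using \<open>u \<in> C\<close> by blast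
        qed
        have "w = \<zero>\<^bsub>M\<^esub> \<oplus>\<^bsub>M\<^esub> \<one> \<odot>\<^bsub>M\<^esub> w" using wc by simp
        then have "w \<in> ?E" using submodule_zero[OF subC] by blast
        then show "C \<noteq> ?E" using w by blast
      qed
      ultimately have E: "strict_chain R M A m ?E"
        unfolding l strict_chain.simps using C(1) by (intro conjI exI[of _ C])
      have "?E \<subseteq> B"
        using w C(2) less.prems(2) by (auto simp: submoduleE subset_iff psubset_eq)
      moreover have "\<not> ?E \<subset> B"
      proof
        assume "?E \<subset> B"
        then have "strict_chain R M A (Suc m) B"
          unfolding strict_chain.simps using E less.prems(2) by (intro conjI exI[of _ ?E])
        from max[OF this] show False by simp
      qed
      ultimately have "y \<in> ?E" using y by blast
      then obtain u r where u: "y = u \<oplus>\<^bsub>M\<^esub> r \<odot>\<^bsub>M\<^esub> w" "u \<in> C" "r \<in> carrier R" by blast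
      then have "y \<ominus>\<^bsub>M\<^esub> r \<odot>\<^bsub>M\<^esub> w = u"
        using wc submodule_carrier[OF subC] by (simp add: a_minus_def M.a_assoc M.r_neg)
      then show "\<exists>r\<in>carrier R. y \<ominus>\<^bsub>M\<^esub> r \<odot>\<^bsub>M\<^esub> w \<in> C" using u by blast
    qed (use subC less.prems C in auto)
    then show ?thesis using composition_series.step[OF k] C by blast
  qed
qed

end

section \<open>Length of quotient modules\<close>

context module
begin

lemma quotient_module_carrier:
  "carrier (quotient_module M A) = (\<lambda>x. A +>\<^bsub>M\<^esub> x) ` carrier M"
  by (auto simp: quotient_module_def A_RCOSETS_def')

lemma quotient_module_add:
  assumes "submodule A R M" "x \<in> carrier M" "y \<in> carrier M"
  shows "(A +>\<^bsub>M\<^esub> x) \<oplus>\<^bsub>quotient_module M A\<^esub> (A +>\<^bsub>M\<^esub> y) = A +>\<^bsub>M\<^esub> (x \<oplus>\<^bsub>M\<^esub> y)"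
proof -
  interpret abelian_subgroup A M
    using assms(1) M.abelian_group_axioms
    by (intro abelian_subgroupI3 additive_subgroupI submodule.axioms(1))
  show ?thesis using a_rcos_sum assms by (simp add: quotient_module_def)
qed

lemma coset_eq_iff:
  assumes "submodule A R M" "x \<in> carrier M" "y \<in> carrier M"
  shows "A +>\<^bsub>M\<^esub> x = A +>\<^bsub>M\<^esub> y \<longleftrightarrow> x \<ominus>\<^bsub>M\<^esub> y \<in> A"
proof
  note A = submodule.axioms(1)[OF assms(1)]
  have sub: "A \<subseteq> carrier M" using submoduleE(1)[OF assms(1)] .
  assume "A +>\<^bsub>M\<^esub> x = A +>\<^bsub>M\<^esub> y"
  then have "A +>\<^bsub>M\<^esub> (x \<oplus>\<^bsub>M\<^esub> \<ominus>\<^bsub>M\<^esub> y) = A"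
    using M.a_coset_add_inv2 assms sub by blast
  then show "x \<ominus>\<^bsub>M\<^esub> y \<in> A"
    using M.a_coset_join1[OF _ _ A] assms by (simp add: a_minus_def)
next
  note A = submodule.axioms(1)[OF assms(1)]
  have sub: "A \<subseteq> carrier M" using submoduleE(1)[OF assms(1)] .
  assume "x \<ominus>\<^bsub>M\<^esub> y \<in> A"
  then have "A +>\<^bsub>M\<^esub> (x \<oplus>\<^bsub>M\<^esub> \<ominus>\<^bsub>M\<^esub> y) = A"
    using M.a_coset_join2[OF _ A] assms by (simp add: a_minus_def)
  then show "A +>\<^bsub>M\<^esub> x = A +>\<^bsub>M\<^esub> y"
    using M.a_coset_add_inv1 assms sub by blast
qed

text \<open>The union over representatives in \<open>quotient_module\<close> has constant terms:
  representatives differ by elements of \<open>A\<close>, hence so do their multiples by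
  \<open>a\<close>.\<close>

lemma quotient_module_smult:
  assumes "submodule A R M" "a \<in> carrier R" "x \<in> carrier M"
  shows "a \<odot>\<^bsub>quotient_module M A\<^esub> (A +>\<^bsub>M\<^esub> x) = A +>\<^bsub>M\<^esub> (a \<odot>\<^bsub>M\<^esub> x)"
proof -
  have "A +>\<^bsub>M\<^esub> (a \<odot>\<^bsub>M\<^esub> x') = A +>\<^bsub>M\<^esub> (a \<odot>\<^bsub>M\<^esub> x)" if x': "x' \<in> A +>\<^bsub>M\<^esub> x" for x'
  proof -
    from x' obtain h where h: "h \<in> A" "x' = h \<oplus>\<^bsub>M\<^esub> x" by (auto simp: a_r_coset_def')
    have hc: "h \<in> carrier M" using h submodule_carrier[OF assms(1)] by blast
    have "a \<odot>\<^bsub>M\<^esub> x' \<ominus>\<^bsub>M\<^esub> a \<odot>\<^bsub>M\<^esub> x = a \<odot>\<^bsub>M\<^esub> h"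
      using assms hc by (simp add: h smult_r_distr a_minus_def M.a_assoc M.r_neg)
    then show ?thesis
      using assms h hc by (subst coset_eq_iff) (simp_all add: submoduleE)
  qed
  moreover have "x \<in> A +>\<^bsub>M\<^esub> x"
    using submodule_zero[OF assms(1)] assms(3) by (auto simp: a_r_coset_def' intro!: bexI[of _ "\<zero>\<^bsub>M\<^esub>"])
  ultimately have "(\<Union>x'\<in>A +>\<^bsub>M\<^esub> x. A +>\<^bsub>M\<^esub> (a \<odot>\<^bsub>M\<^esub> x')) = A +>\<^bsub>M\<^esub> (a \<odot>\<^bsub>M\<^esub> x)"
    by (intro SUP_eq_const) blast+
  then show ?thesis by (simp add: quotient_module_def)
qed

lemma quotient_module_zero: "\<zero>\<^bsub>quotient_module M A\<^esub> = A"
  by (simp add: quotient_module_def)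

lemma module_quotient_module:
  assumes A: "submodule A R M"
  shows "module R (quotient_module M A)"
proof -
  let ?Q = "quotient_module M A"
  note simps = quotient_module_carrier quotient_module_add[OF A] quotient_module_smult[OF A]
    quotient_module_zero
  have zero: "A = A +>\<^bsub>M\<^esub> \<zero>\<^bsub>M\<^esub>" using submoduleE(1)[OF A] by simp
  have zero_add: "A \<oplus>\<^bsub>?Q\<^esub> (A +>\<^bsub>M\<^esub> x) = A +>\<^bsub>M\<^esub> x" if "x \<in> carrier M" for x
    using quotient_module_add[OF A M.zero_closed that] that zero by simp
  show ?thesis
  proof (rule moduleI)
    show "cring R" by (rule R.cring_axioms)
    show "abelian_group ?Q"
    proof (rule abelian_groupI)
      show "\<zero>\<^bsub>?Q\<^esub> \<in> carrier ?Q" using zero by (auto simp: simps)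
      fix X assume "X \<in> carrier ?Q"
      then obtain x where x: "X = A +>\<^bsub>M\<^esub> x" "x \<in> carrier M" by (auto simp: simps)
      then show "\<zero>\<^bsub>?Q\<^esub> \<oplus>\<^bsub>?Q\<^esub> X = X" by (simp add: quotient_module_zero zero_add)
      show "\<exists>Y\<in>carrier ?Q. Y \<oplus>\<^bsub>?Q\<^esub> X = \<zero>\<^bsub>?Q\<^esub>"
        by (rule bexI[of _ "A +>\<^bsub>M\<^esub> (\<ominus>\<^bsub>M\<^esub> x)"])
           (use x zero in \<open>auto simp: simps M.l_neg\<close>)
    qed (auto simp: simps M.a_ac)
  qed (auto simp: simps smult_l_distr smult_r_distr smult_assoc1)
qed

definition preimage_in :: "'c set \<Rightarrow> 'c set set \<Rightarrow> 'c set"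
  where "preimage_in A H = {x \<in> carrier M. A +>\<^bsub>M\<^esub> x \<in> H}"

lemma submodule_preimage:
  assumes A: "submodule A R M" and H: "submodule H R (quotient_module M A)"
  shows "submodule (preimage_in A H) R M" and "A \<subseteq> preimage_in A H"
    and "(\<lambda>x. A +>\<^bsub>M\<^esub> x) ` preimage_in A H = H"
proof -
  interpret Q: module R "quotient_module M A" by (rule module_quotient_module[OF A])
  have coset_A: "A +>\<^bsub>M\<^esub> x = A" if "x \<in> A" for x
    using M.a_coset_join2[OF _ submodule.axioms(1)[OF A] that] submodule_carrier[OF A that] by blast
  have "A \<in> H" using Q.submodule_zero[OF H] by (simp add: quotient_module_zero)
  show "A \<subseteq> preimage_in A H"
    using \<open>A \<in> H\<close> coset_A submodule_carrier[OF A] by (auto simp: preimage_in_def)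
  have smult: "a \<odot>\<^bsub>M\<^esub> x \<in> preimage_in A H" if "a \<in> carrier R" "x \<in> preimage_in A H" for a x
    using that Q.submoduleE(4)[OF H that(1), of "A +>\<^bsub>M\<^esub> x"]
    by (auto simp: preimage_in_def quotient_module_smult[OF A])
  show "submodule (preimage_in A H) R M"
  proof (rule submoduleI)
    show "\<zero>\<^bsub>M\<^esub> \<in> preimage_in A H" using \<open>A \<subseteq> preimage_in A H\<close> submodule_zero[OF A] by blast
    fix x assume x: "x \<in> preimage_in A H"
    \<comment> \<open>Inverses are obtained by scaling with \<open>\<ominus> \<one>\<close>, so
      closure under scalars covers them.\<close>
    then have "\<ominus>\<^bsub>M\<^esub> x = (\<ominus> \<one>) \<odot>\<^bsub>M\<^esub> x" by (simp add: preimage_in_def smult_l_minus)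
    then show "\<ominus>\<^bsub>M\<^esub> x \<in> preimage_in A H" using smult[OF _ x, of "\<ominus> \<one>"] by simp
    fix y assume y: "y \<in> preimage_in A H"
    show "x \<oplus>\<^bsub>M\<^esub> y \<in> preimage_in A H"
      using x y Q.submoduleE(5)[OF H, of "A +>\<^bsub>M\<^esub> x" "A +>\<^bsub>M\<^esub> y"]
      by (auto simp: preimage_in_def quotient_module_add[OF A])
  qed (auto simp: smult, auto simp: preimage_in_def)
  show "(\<lambda>x. A +>\<^bsub>M\<^esub> x) ` preimage_in A H = H"
    using Q.submoduleE(1)[OF H] by (force simp: preimage_in_def quotient_module_carrier)
qed

lemma submodule_coset_image:
  assumes A: "submodule A R M" and W: "submodule W R M" and "A \<subseteq> W"
  shows "submodule ((\<lambda>x. A +>\<^bsub>M\<^esub> x) ` W) R (quotient_module M A)"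
    and "preimage_in A ((\<lambda>x. A +>\<^bsub>M\<^esub> x) ` W) = W"
proof -
  interpret Q: module R "quotient_module M A" by (rule module_quotient_module[OF A])
  note car = submodule_carrier[OF W]
  let ?H = "(\<lambda>x. A +>\<^bsub>M\<^esub> x) ` W"
  have smult: "a \<odot>\<^bsub>quotient_module M A\<^esub> X \<in> ?H" if "a \<in> carrier R" "X \<in> ?H" for a X
    using that car submoduleE(4)[OF W] by (auto simp: quotient_module_smult[OF A])
  show "submodule ?H R (quotient_module M A)"
  proof (rule Q.submoduleI)
    show "\<zero>\<^bsub>quotient_module M A\<^esub> \<in> ?H"
      using submodule_zero[OF W] submoduleE(1)[OF A]
      by (auto simp: quotient_module_zero intro!: image_eqI[of _ _ "\<zero>\<^bsub>M\<^esub>"])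
    show sub: "?H \<subseteq> carrier (quotient_module M A)" using car by (auto simp: quotient_module_carrier)
    fix X assume X: "X \<in> ?H"
    then have "\<ominus>\<^bsub>quotient_module M A\<^esub> X = (\<ominus> \<one>) \<odot>\<^bsub>quotient_module M A\<^esub> X"
      using sub by (subst Q.smult_l_minus) auto
    then show "\<ominus>\<^bsub>quotient_module M A\<^esub> X \<in> ?H" using smult[OF _ X, of "\<ominus> \<one>"] by simp
    fix Y assume "Y \<in> ?H"
    then show "X \<oplus>\<^bsub>quotient_module M A\<^esub> Y \<in> ?H"
      using X car submoduleE(5)[OF W] by (auto simp: quotient_module_add[OF A])
  qed (rule smult)
  show "preimage_in A ?H = W"
  proof
    show "W \<subseteq> preimage_in A ?H" using car by (auto simp: preimage_in_def)
    show "preimage_in A ?H \<subseteq> W"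
    proof
      fix x assume "x \<in> preimage_in A ?H"
      then obtain w where w: "x \<in> carrier M" "w \<in> W" "A +>\<^bsub>M\<^esub> x = A +>\<^bsub>M\<^esub> w"
        by (auto simp: preimage_in_def)
      then have "x \<ominus>\<^bsub>M\<^esub> w \<in> W" using coset_eq_iff[OF A w(1) car[OF w(2)]] \<open>A \<subseteq> W\<close> by blast
      then show "x \<in> W" by (rule submodule_add_cancel[OF W w(1,2)])
    qed
  qed
qed

text \<open>The correspondence theorem for \<open>M/A\<close>: images and preimages are mutually
  inverse between submodules of the quotient and submodules above \<open>A\<close>, so strict
  inclusions stay strict.\<close>

lemma strict_chain_quotient_iff:
  assumes A: "submodule A R M"
  shows "(\<exists>N. (\<forall>i\<le>n. submodule (N i) R (quotient_module M A)) \<and> (\<forall>i<n. N i \<subset> N (Suc i)))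
    \<longleftrightarrow> (\<exists>B. strict_chain R M A n B)"
proof
  assume "\<exists>N. (\<forall>i\<le>n. submodule (N i) R (quotient_module M A)) \<and> (\<forall>i<n. N i \<subset> N (Suc i))"
  then obtain N where
    N: "(\<forall>i\<le>n. submodule (N i) R (quotient_module M A)) \<and> (\<forall>i<n. N i \<subset> N (Suc i))"
    by (rule exE)
  have "strict_chain R M A n (preimage_in A (N n))"
  proof (rule strict_chainI[where N = "\<lambda>i. preimage_in A (N i)"])
    fix i assume "i < n"
    then have sub: "submodule (N i) R (quotient_module M A)"
      "submodule (N (Suc i)) R (quotient_module M A)" and "N i \<subset> N (Suc i)"
      using N by auto
    have "preimage_in A (N i) \<noteq> preimage_in A (N (Suc i))"
      using submodule_preimage(3)[OF A sub(1)] submodule_preimage(3)[OF A sub(2)] \<open>N i \<subset> N (Suc i)\<close>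
      by (metis less_irrefl)
    then show "preimage_in A (N i) \<subset> preimage_in A (N (Suc i))"
      using \<open>N i \<subset> N (Suc i)\<close> unfolding preimage_in_def by auto
  qed (use N submodule_preimage[OF A] in simp_all)
  then show "\<exists>B. strict_chain R M A n B" ..
next
  let ?\<pi> = "\<lambda>W. (\<lambda>x. A +>\<^bsub>M\<^esub> x) ` W"
  assume "\<exists>B. strict_chain R M A n B"
  then obtain B where "strict_chain R M A n B" ..
  from strict_chain_terms[OF this] obtain N where
    N: "(\<forall>i\<le>n. submodule (N i) R M \<and> A \<subseteq> N i) \<and> (\<forall>i<n. N i \<subset> N (Suc i)) \<and> N n = B"
    by (rule exE)
  show "\<exists>N. (\<forall>i\<le>n. submodule (N i) R (quotient_module M A)) \<and> (\<forall>i<n. N i \<subset> N (Suc i))"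
  proof (rule exI[of _ "\<lambda>i. ?\<pi> (N i)"], intro conjI allI impI)
    fix i assume "i \<le> n"
    then show "submodule (?\<pi> (N i)) R (quotient_module M A)"
      using N by (intro submodule_coset_image A) auto
  next
    fix i assume "i < n"
    then have i: "submodule (N i) R M" "A \<subseteq> N i" "submodule (N (Suc i)) R M" "A \<subseteq> N (Suc i)"
      "N i \<subset> N (Suc i)"
      using N by auto
    have "?\<pi> (N i) \<noteq> ?\<pi> (N (Suc i))"
      using submodule_coset_image(2)[OF A i(1,2)] submodule_coset_image(2)[OF A i(3,4)] i(5)
      by (metis less_irrefl)
    then show "?\<pi> (N i) \<subset> ?\<pi> (N (Suc i))" using i(5) by (simp add: image_mono psubset_eq)
  qed
qed

section \<open>Length of a quotient through composition series\<close>

lemma module_length_quotient: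
  assumes "submodule A R M"
  shows "module_length R (quotient_module M A) = Sup {enat n | n. \<exists>B. strict_chain R M A n B}"
  unfolding module_length_def strict_chain_quotient_iff[OF assms] ..

text \<open>The series itself is a chain with \<open>k\<close> steps and the rank bound excludes
  longer ones, so the supremum is attained.\<close>

lemma module_length_quotient_eq:
  assumes "composition_series R M A k (carrier M)"
  shows "module_length R (quotient_module M A) = enat k"
proof -
  have A: "submodule A R M" using composition_series_submodules[OF assms] by blast
  show ?thesis
    unfolding module_length_quotient[OF A]
  proof (rule antisym[OF Sup_least Sup_upper])
    fix l assume "l \<in> {enat n | n. \<exists>B. strict_chain R M A n B}"
    then obtain n B where n: "l = enat n" "strict_chain R M A n B" by blast
    then show "l \<le> enat k"
      using strict_chain_le_composition_series[OF assms n(2)] submoduleE(1)[OF strict_chain_submodule[OF n(2)]]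
      by simp
  qed (use composition_series_strict_chain[OF assms] in blast)
qed

lemma composition_series_of_finite_length:
  assumes A: "submodule A R M" and "module_length R (quotient_module M A) < \<infinity>"
  shows "\<exists>k. composition_series R M A k (carrier M)"
proof -
  obtain b where b: "module_length R (quotient_module M A) = enat b"
    using assms(2) by (cases "module_length R (quotient_module M A)") auto
  have "n \<le> b" if "strict_chain R M A n B" for n B
  proof -
    have "enat n \<le> module_length R (quotient_module M A)"
      unfolding module_length_quotient[OF A] by (rule Sup_upper) (use that in blast)
    then show ?thesis by (simp add: b)
  qed
  then show ?thesis
    by (intro composition_series_exists A carrier_is_submodule submoduleE(1))
qed

end

section \<open>The monomial filtration\<close>

fun power_product :: "('a, 'r) ring_scheme \<Rightarrow> 'a list \<Rightarrow> nat list \<Rightarrow> 'a"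
  where
  "power_product R (x # xs) (a # \<alpha>) = x [^]\<^bsub>R\<^esub> a \<otimes>\<^bsub>R\<^esub> power_product R xs \<alpha>"
| "power_product R _ _ = \<one>\<^bsub>R\<^esub>"

abbreviation exponent_add :: "nat list \<Rightarrow> nat list \<Rightarrow> nat list"  (infixl "\<oplus>\<oplus>" 65)
  where "\<alpha> \<oplus>\<oplus> \<beta> \<equiv> map2 (+) \<alpha> \<beta>"

text \<open>The sign puts monomials of larger degree first, so that \<open>J\<^sup>n\<^sup>+\<^sup>1M\<close> lies below every monomial of
  degree at most \<open>n\<close>; ties are broken lexicographically.\<close>

definition local_rank :: "nat list \<Rightarrow> int list"
  where "local_rank \<alpha> = - int (sum_list \<alpha>) # map int \<alpha>"

lemma exponent_add_in_exponents: "\<alpha> \<in> exponents d \<Longrightarrow> \<beta> \<in> exponents d \<Longrightarrow> \<alpha> \<oplus>\<oplus> \<beta> \<in> exponents d"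
  by (simp add: exponents_def)

lemma sum_list_exponent_add:
  "length \<alpha> = length \<beta> \<Longrightarrow> sum_list (\<alpha> \<oplus>\<oplus> \<beta>) = sum_list \<alpha> + sum_list \<beta>"
  by (induction \<alpha> \<beta> rule: list_induct2) auto

text \<open>Multiplying monomials by a common one changes both degrees by the same amount and leaves
  the lexicographic comparison of lists of equal length intact.\<close>

lemma local_rank_add_less:
  assumes "\<alpha> \<in> exponents d" "\<beta> \<in> exponents d" "\<gamma> \<in> exponents d" "local_rank \<alpha> < local_rank \<beta>"
  shows "local_rank (\<gamma> \<oplus>\<oplus> \<alpha>) < local_rank (\<gamma> \<oplus>\<oplus> \<beta>)"
proof -
  have len: "length \<alpha> = length \<beta>" "length \<beta> = length \<gamma>" using assms by (auto simp: exponents_def)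
  then have "map int (\<gamma> \<oplus>\<oplus> \<alpha>) < map int (\<gamma> \<oplus>\<oplus> \<beta>) \<longleftrightarrow> map int \<alpha> < map int \<beta>"
    by (induction \<alpha> \<beta> \<gamma> rule: list_induct3) auto
  with assms(4) len show ?thesis by (auto simp: local_rank_def sum_list_exponent_add)
qed

lemma local_rank_eq_iff: "local_rank \<alpha> = local_rank \<beta> \<longleftrightarrow> \<alpha> = \<beta>"
  by (auto simp: local_rank_def inj_map_eq_map[OF inj_of_nat])

lemma local_rank_less_if_degree_greater: "sum_list \<beta> < sum_list \<alpha> \<Longrightarrow> local_rank \<alpha> < local_rank \<beta>"
  by (simp add: local_rank_def)

lemma exponent_diff:
  assumes "list_all2 (\<le>) \<beta> \<alpha>"
  shows "\<exists>\<gamma>. length \<gamma> = length \<alpha> \<and> \<gamma> \<oplus>\<oplus> \<beta> = \<alpha>"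
  using assms
proof (induction rule: list_all2_induct)
  case (Cons b \<beta> a \<alpha>)
  then obtain \<gamma> where "length \<gamma> = length \<alpha>" "\<gamma> \<oplus>\<oplus> \<beta> = \<alpha>" by blast
  then show ?case using Cons(1) by (intro exI[of _ "(a - b) # \<gamma>"]) simp
qed simp

section \<open>Power products and powers of ideals\<close>

context cring
begin

lemma power_product_closed: "set xs \<subseteq> carrier R \<Longrightarrow> power_product R xs \<alpha> \<in> carrier R"
proof (induction xs arbitrary: \<alpha>)
  case (Cons x xs)
  then show ?case by (cases \<alpha>) auto
qed simp

lemma power_product_add:
  assumes "length \<alpha> = length \<beta>" "length \<beta> = length xs" "set xs \<subseteq> carrier R"
  shows "power_product R xs (\<alpha> \<oplus>\<oplus> \<beta>) = power_product R xs \<alpha> \<otimes> power_product R xs \<beta>"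
  using assms
  by (induction \<alpha> \<beta> xs rule: list_induct3)
     (auto simp: nat_pow_mult[symmetric] power_product_closed m_ac)

lemma power_product_zero: "set xs \<subseteq> carrier R \<Longrightarrow> power_product R xs (replicate (length xs) 0) = \<one>"
  by (induction xs) auto

text \<open>A parameter is a monomial of degree one, so multiplying by it raises degrees by
  one.\<close>

lemma power_product_unit:
  assumes "x \<in> set xs" "set xs \<subseteq> carrier R"
  shows "\<exists>\<epsilon>\<in>exponents (length xs). sum_list \<epsilon> = 1 \<and> power_product R xs \<epsilon> = x"
  using assms
proof (induction xs)
  case (Cons y ys)
  show ?case
  proof (cases "x = y")
    case True
    have "power_product R (y # ys) (1 # replicate (length ys) 0) = x"
      using Cons.prems True by (simp add: power_product_zero)
    then show ?thesis
      by (intro bexI[of _ "1 # replicate (length ys) 0"]) (auto simp: exponents_def sum_list_replicate)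
  next
    case False
    then obtain \<epsilon> where "\<epsilon> \<in> exponents (length ys)" "sum_list \<epsilon> = 1" "power_product R ys \<epsilon> = x"
      using Cons by auto
    then show ?thesis
      using Cons.prems by (intro bexI[of _ "0 # \<epsilon>"]) (auto simp: exponents_def)
  qed
qed simp

lemma ideal_power_ideal:
  assumes "ideal J R"
  shows "ideal (J [^]\<^bsub>ideals_set R\<^esub> (n :: nat)) R"
proof -
  interpret I: comm_monoid "ideals_set R" by (rule ideals_set_is_comm_monoid)
  show ?thesis
    using I.nat_pow_closed[of J n] assms by (simp add: ideals_set_def)
qed

lemma ideal_power_Suc:
  fixes n :: nat
  shows "J [^]\<^bsub>ideals_set R\<^esub> Suc n = (J [^]\<^bsub>ideals_set R\<^esub> n) \<cdot> J"
proof -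
  interpret I: comm_monoid "ideals_set R" by (rule ideals_set_is_comm_monoid)
  show ?thesis by (simp add: ideals_set_def)
qed

lemma ideal_power_add:
  assumes "ideal J R"
  shows "(J [^]\<^bsub>ideals_set R\<^esub> (m :: nat)) \<cdot> (J [^]\<^bsub>ideals_set R\<^esub> (n :: nat)) = J [^]\<^bsub>ideals_set R\<^esub> (m + n)"
proof -
  interpret I: comm_monoid "ideals_set R" by (rule ideals_set_is_comm_monoid)
  show ?thesis using I.nat_pow_mult[of J m n] assms by (simp add: ideals_set_def)
qed

lemma ideal_power_1:
  assumes "ideal J R"
  shows "J [^]\<^bsub>ideals_set R\<^esub> (1 :: nat) = J"
proof -
  interpret I: comm_monoid "ideals_set R" by (rule ideals_set_is_comm_monoid)
  show ?thesis using I.nat_pow_eone[of J] assms by (simp add: ideals_set_def)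
qed

lemma ideal_power_antimono:
  fixes m n :: nat
  assumes "ideal J R" "m \<le> n"
  shows "J [^]\<^bsub>ideals_set R\<^esub> n \<subseteq> J [^]\<^bsub>ideals_set R\<^esub> m"
  using ideal_prod_inter[OF ideal_power_ideal[OF assms(1), of m] ideal_power_ideal[OF assms(1), of "n - m"]]
    ideal_power_add[OF assms(1), of m "n - m"] assms(2)
  by simp

lemma pow_in_ideal_power:
  fixes n :: nat
  assumes "ideal J R" "x \<in> J"
  shows "x [^] n \<in> J [^]\<^bsub>ideals_set R\<^esub> n"
proof (induction n)
  case 0
  show ?case by (simp add: nat_pow_def ideals_set_def)
next
  case (Suc n)
  then show ?case
    unfolding ideal_power_Suc nat_pow_Suc by (intro ideal_prod.prod assms(2))
qed

lemma power_product_in_ideal_power: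
  assumes "ideal J R" "set xs \<subseteq> J" "length \<alpha> = length xs"
  shows "power_product R xs \<alpha> \<in> J [^]\<^bsub>ideals_set R\<^esub> sum_list \<alpha>"
  using assms(3,2)
proof (induction \<alpha> xs rule: list_induct2)
  case Nil
  show ?case by (simp add: nat_pow_def ideals_set_def)
next
  case (Cons a \<alpha> x xs)
  then have "x [^] a \<otimes> power_product R xs \<alpha> \<in>
      (J [^]\<^bsub>ideals_set R\<^esub> a) \<cdot> (J [^]\<^bsub>ideals_set R\<^esub> sum_list \<alpha>)"
    by (intro ideal_prod.prod pow_in_ideal_power assms(1)) auto
  then show ?case by (simp add: ideal_power_add[OF assms(1)])
qed

end

section \<open>Monomial spans, powers of \<open>J\<close> and layers\<close>

context module
begin

text \<open>Two kinds of \<open>B\<close> matter: the exponents of degree at least \<open>n\<close>,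
  giving \<open>J^n M\<close>, and the exponents before some \<open>\<alpha>\<close>, giving the
  lower part of a layer.\<close>

definition monomial_span :: "'a list \<Rightarrow> nat list set \<Rightarrow> 'c set"
  where "monomial_span xs B =
    submodule_span R M {power_product R xs \<beta> \<odot>\<^bsub>M\<^esub> y | \<beta> y. \<beta> \<in> B \<and> y \<in> carrier M}"

lemma monomial_span_generators:
  "set xs \<subseteq> carrier R \<Longrightarrow>
    {power_product R xs \<beta> \<odot>\<^bsub>M\<^esub> y | \<beta> y. \<beta> \<in> B \<and> y \<in> carrier M} \<subseteq> carrier M"
  by (auto simp: R.power_product_closed)

lemma submodule_monomial_span: "set xs \<subseteq> carrier R \<Longrightarrow> submodule (monomial_span xs B) R M"
  unfolding monomial_span_def by (intro submodule_span_is_submodule monomial_span_generators)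

lemma monomial_spanI:
  "\<beta> \<in> B \<Longrightarrow> y \<in> carrier M \<Longrightarrow> power_product R xs \<beta> \<odot>\<^bsub>M\<^esub> y \<in> monomial_span xs B"
  unfolding monomial_span_def by (rule subsetD[OF submodule_span_superset]) blast

lemma monomial_span_minimal:
  assumes "submodule N R M"
    and "\<And>\<beta> y. \<beta> \<in> B \<Longrightarrow> y \<in> carrier M \<Longrightarrow> power_product R xs \<beta> \<odot>\<^bsub>M\<^esub> y \<in> N"
  shows "monomial_span xs B \<subseteq> N"
  unfolding monomial_span_def using assms by (intro submodule_span_minimal) auto

lemma monomial_span_mono:
  "set xs \<subseteq> carrier R \<Longrightarrow> B \<subseteq> B' \<Longrightarrow> monomial_span xs B \<subseteq> monomial_span xs B'"
  by (intro monomial_span_minimal submodule_monomial_span) (auto intro: monomial_spanI)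

lemma smult_monomial_span:
  assumes xs: "set xs \<subseteq> carrier R" and "B \<subseteq> exponents (length xs)" "\<gamma> \<in> exponents (length xs)"
    and B': "\<And>\<beta>. \<beta> \<in> B \<Longrightarrow> \<gamma> \<oplus>\<oplus> \<beta> \<in> B'" and y: "y \<in> monomial_span xs B"
  shows "power_product R xs \<gamma> \<odot>\<^bsub>M\<^esub> y \<in> monomial_span xs B'"
proof (rule smult_span_closed[OF submodule_monomial_span[OF xs] R.power_product_closed[OF xs]
      monomial_span_generators[OF xs] _ y[unfolded monomial_span_def]])
  fix s assume "s \<in> {power_product R xs \<beta> \<odot>\<^bsub>M\<^esub> y | \<beta> y. \<beta> \<in> B \<and> y \<in> carrier M}"
  then obtain \<beta> z where s: "s = power_product R xs \<beta> \<odot>\<^bsub>M\<^esub> z" "\<beta> \<in> B" "z \<in> carrier M" by blast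
  then have "power_product R xs \<gamma> \<odot>\<^bsub>M\<^esub> s = power_product R xs (\<gamma> \<oplus>\<oplus> \<beta>) \<odot>\<^bsub>M\<^esub> z"
    using assms(2,3) xs
    by (subst R.power_product_add) (auto simp: exponents_def smult_assoc1 R.power_product_closed)
  then show "power_product R xs \<gamma> \<odot>\<^bsub>M\<^esub> s \<in> monomial_span xs B'"
    using B'[OF s(2)] s(3) by (simp add: monomial_spanI)
qed

lemma monomial_span_insert:
  assumes xs: "set xs \<subseteq> carrier R"
  shows "monomial_span xs (insert \<alpha> B) =
    add_multiples (power_product R xs \<alpha>) (monomial_span xs B) (carrier M)"
proof
  note sub = submodule_monomial_span[OF xs] carrier_is_submodule R.power_product_closed[OF xs]
  show "monomial_span xs (insert \<alpha> B) \<subseteq>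
      add_multiples (power_product R xs \<alpha>) (monomial_span xs B) (carrier M)"
  proof (rule monomial_span_minimal)
    fix \<beta> y assume "\<beta> \<in> insert \<alpha> B" and y: "y \<in> carrier M"
    then consider "\<beta> = \<alpha>" | "\<beta> \<in> B" by blast
    then show "power_product R xs \<beta> \<odot>\<^bsub>M\<^esub> y \<in>
        add_multiples (power_product R xs \<alpha>) (monomial_span xs B) (carrier M)"
    proof cases
      case 1
      then show ?thesis using smult_in_add_multiples[OF sub y] by simp
    next
      case 2
      then show ?thesis
        using add_multiples_superset[OF sub] monomial_spanI[OF 2 y] by blast
    qed
  qed (intro submodule_add_multiples sub)
  show "add_multiples (power_product R xs \<alpha>) (monomial_span xs B) (carrier M) \<subseteq>
      monomial_span xs (insert \<alpha> B)"
    by (intro add_multiples_minimal sub monomial_span_mono xs monomial_spanI) auto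
qed

text \<open>Degrees above \<open>n\<close> are kept so that the exponents form an initial segment of
  the local order. One inclusion is an induction along \<open>J^(n+1) = J^n J\<close>; the other
  holds because a monomial of degree \<open>m \<ge> n\<close> lies in
  \<open>J^m \<subseteq> J^n\<close>.\<close>

lemma ideal_smult_power:
  assumes xs: "set xs \<subseteq> carrier R" and J: "J = genideal R (set xs)"
  shows "ideal_smult R (J [^]\<^bsub>ideals_set R\<^esub> (n :: nat)) M =
    monomial_span xs {\<beta> \<in> exponents (length xs). n \<le> sum_list \<beta>}"
proof
  let ?K = "\<lambda>n. monomial_span xs {\<beta> \<in> exponents (length xs). n \<le> sum_list \<beta>}"
  note sub = submodule_monomial_span[OF xs]
  have idJ: "ideal J R" unfolding J by (rule R.genideal_ideal[OF xs])
  have xsJ: "set xs \<subseteq> J" unfolding J by (rule R.genideal_self[OF xs])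
  \<comment> \<open>The transporter of \<open>?K n\<close> into \<open>?K (Suc n)\<close> is an
    ideal containing every parameter, hence contains \<open>J\<close>.\<close>
  have J_K: "j \<odot>\<^bsub>M\<^esub> s \<in> ?K (Suc n)" if "j \<in> J" "s \<in> ?K n" for j s n
  proof -
    have "set xs \<subseteq> {a \<in> carrier R. \<forall>s\<in>?K n. a \<odot>\<^bsub>M\<^esub> s \<in> ?K (Suc n)}"
    proof
      fix x assume x: "x \<in> set xs"
      then obtain \<epsilon> where \<epsilon>: "\<epsilon> \<in> exponents (length xs)" "sum_list \<epsilon> = 1" "power_product R xs \<epsilon> = x"
        using R.power_product_unit[OF x xs] by blast
      have "x \<odot>\<^bsub>M\<^esub> s \<in> ?K (Suc n)" if "s \<in> ?K n" for s
        unfolding \<epsilon>(3)[symmetric]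
        by (rule smult_monomial_span[OF xs _ \<epsilon>(1) _ that])
           (use \<epsilon>(1,2) in \<open>auto simp: exponents_def sum_list_exponent_add\<close>)
      then show "x \<in> {a \<in> carrier R. \<forall>s\<in>?K n. a \<odot>\<^bsub>M\<^esub> s \<in> ?K (Suc n)}" using x xs by blast
    qed
    then have "J \<subseteq> {a \<in> carrier R. \<forall>s\<in>?K n. a \<odot>\<^bsub>M\<^esub> s \<in> ?K (Suc n)}"
      unfolding J by (intro R.genideal_minimal ideal_transporter sub submoduleE(1))
    then show ?thesis using that by blast
  qed
  have "a \<in> J [^]\<^bsub>ideals_set R\<^esub> n \<Longrightarrow> y \<in> carrier M \<Longrightarrow> a \<odot>\<^bsub>M\<^esub> y \<in> ?K n" for a y n
  proof (induction n arbitrary: a y)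
    case 0
    have "y = power_product R xs (replicate (length xs) 0) \<odot>\<^bsub>M\<^esub> y"
      using 0(2) xs by (simp add: R.power_product_zero)
    also have "\<dots> \<in> ?K 0" using 0(2) by (intro monomial_spanI) (auto simp: exponents_def)
    finally show ?case
      using 0(1) ideal.Icarr[OF R.ideal_power_ideal[OF idJ]] by (intro submoduleE(4)[OF sub])
  next
    case (Suc n)
    from Suc.prems(1) have "a \<in> (J [^]\<^bsub>ideals_set R\<^esub> n) \<cdot>\<^bsub>R\<^esub> J"
      by (simp only: R.ideal_power_Suc)
    \<comment> \<open>Membership in the carrier is carried along for the distributive law in the sum
      case.\<close>
    then have "a \<in> carrier R \<and> a \<odot>\<^bsub>M\<^esub> y \<in> ?K (Suc n)"
    proof induction
      case (prod i j)
      have car: "i \<in> carrier R" "j \<in> carrier R"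
        using prod ideal.Icarr[OF R.ideal_power_ideal[OF idJ]] ideal.Icarr[OF idJ] by auto
      \<comment> \<open>With the factors swapped, \<open>i \<in> J^n\<close> acts first, by the
        induction hypothesis, and \<open>j \<in> J\<close> then raises the degree.\<close>
      have "(i \<otimes> j) \<odot>\<^bsub>M\<^esub> y = j \<odot>\<^bsub>M\<^esub> (i \<odot>\<^bsub>M\<^esub> y)"
        using car Suc.prems(2) by (simp add: R.m_comm[of i j] smult_assoc1)
      then show ?case using J_K[OF prod(2) Suc.IH[OF prod(1) Suc.prems(2)]] car by simp
    next
      case (sum a b)
      then show ?case using Suc.prems(2) by (simp add: smult_l_distr submoduleE(5)[OF sub])
    qed
    then show ?case ..
  qed
  then show "ideal_smult R (J [^]\<^bsub>ideals_set R\<^esub> n) M \<subseteq> ?K n"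
    unfolding ideal_smult_def by (intro submodule_span_minimal sub) auto
  have gen: "{a \<odot>\<^bsub>M\<^esub> y | a y. a \<in> J [^]\<^bsub>ideals_set R\<^esub> n \<and> y \<in> carrier M} \<subseteq> carrier M"
    using ideal.Icarr[OF R.ideal_power_ideal[OF idJ]] by auto
  show "?K n \<subseteq> ideal_smult R (J [^]\<^bsub>ideals_set R\<^esub> n) M"
    unfolding ideal_smult_def
  proof (rule monomial_span_minimal[OF submodule_span_is_submodule[OF gen]])
    fix \<beta> y assume \<beta>: "\<beta> \<in> {\<beta> \<in> exponents (length xs). n \<le> sum_list \<beta>}" and "y \<in> carrier M"
    have "power_product R xs \<beta> \<in> J [^]\<^bsub>ideals_set R\<^esub> n"
      using R.power_product_in_ideal_power[OF idJ xsJ, of \<beta>] R.ideal_power_antimono[OF idJ, of n "sum_list \<beta>"] \<beta>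
      by (auto simp: exponents_def)
    then show "power_product R xs \<beta> \<odot>\<^bsub>M\<^esub> y \<in>
        submodule_span R M {a \<odot>\<^bsub>M\<^esub> y | a y. a \<in> J [^]\<^bsub>ideals_set R\<^esub> n \<and> y \<in> carrier M}"
      using \<open>y \<in> carrier M\<close> by (intro subsetD[OF submodule_span_superset]) blast
  qed
qed

text \<open>With \<open>N = M\<^sub>i\<close> this is the submodule
  \<open>U\<^sub>\<alpha>\<^sub>,\<^sub>i\<close> of the filtration.\<close>

definition layer :: "'a list \<Rightarrow> 'c set \<Rightarrow> nat list \<Rightarrow> 'c set"
  where "layer xs N \<alpha> = add_multiples (power_product R xs \<alpha>)
    (monomial_span xs {\<beta> \<in> exponents (length xs). local_rank \<beta> < local_rank \<alpha>}) N"

text \<open>If the layers agree at \<open>\<beta>\<close>, each \<open>x^\<beta> y\<close> with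
  \<open>y \<in> N'\<close> lies in \<open>x^\<beta> N\<close> plus earlier terms. Multiplying by
  \<open>x^\<gamma>\<close> carries this relation to \<open>\<alpha> = \<gamma> + \<beta>\<close>,
  since the order is compatible with multiplication, so the layers agree at \<open>\<alpha>\<close>
  as well.\<close>

lemma down_set_layer:
  assumes xs: "set xs \<subseteq> carrier R" and "simple_step R M N N'"
  shows "down_set (length xs) {\<alpha> \<in> exponents (length xs). layer xs N \<alpha> \<noteq> layer xs N' \<alpha>}"
  unfolding down_set_def
proof (intro conjI ballI allI impI)
  have N: "submodule N R M" "submodule N' R M" "N \<subseteq> N'"
    using assms(2) by (auto simp: simple_step_def)
  note sub = submodule_monomial_span[OF xs] R.power_product_closed[OF xs]
  fix \<alpha> \<beta> assume \<alpha>: "\<alpha> \<in> {\<alpha> \<in> exponents (length xs). layer xs N \<alpha> \<noteq> layer xs N' \<alpha>}"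
    and "list_all2 (\<le>) \<beta> \<alpha>"
  then have \<beta>: "\<beta> \<in> exponents (length xs)" by (auto simp: exponents_def dest: list_all2_lengthD)
  from \<open>list_all2 (\<le>) \<beta> \<alpha>\<close> obtain \<gamma> where \<gamma>: "\<gamma> \<in> exponents (length xs)" "\<gamma> \<oplus>\<oplus> \<beta> = \<alpha>"
    using exponent_diff[of \<beta> \<alpha>] \<alpha> by (auto simp: exponents_def)
  have "layer xs N \<beta> \<noteq> layer xs N' \<beta>"
  proof
    assume eq: "layer xs N \<beta> = layer xs N' \<beta>"
    have "layer xs N' \<alpha> \<subseteq> layer xs N \<alpha>"
      unfolding layer_def[of xs N' \<alpha>]
    proof (rule add_multiples_minimal)
      show subN: "submodule (layer xs N \<alpha>) R M"
        unfolding layer_def by (intro submodule_add_multiples sub N)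
      show "monomial_span xs {\<beta> \<in> exponents (length xs). local_rank \<beta> < local_rank \<alpha>} \<subseteq> layer xs N \<alpha>"
        unfolding layer_def by (intro add_multiples_superset sub N)
      fix y assume y: "y \<in> N'"
      have yc: "y \<in> carrier M" by (rule submodule_carrier[OF N(2) y])
      have "power_product R xs \<beta> \<odot>\<^bsub>M\<^esub> y \<in> layer xs N' \<beta>"
        unfolding layer_def by (intro smult_in_add_multiples sub N y)
      then have "power_product R xs \<beta> \<odot>\<^bsub>M\<^esub> y \<in> layer xs N \<beta>" by (simp add: eq)
      then obtain u z where uz: "power_product R xs \<beta> \<odot>\<^bsub>M\<^esub> y = u \<oplus>\<^bsub>M\<^esub> power_product R xs \<beta> \<odot>\<^bsub>M\<^esub> z"
        "u \<in> monomial_span xs {\<beta>' \<in> exponents (length xs). local_rank \<beta>' < local_rank \<beta>}" "z \<in> N"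
        unfolding layer_def add_multiples_def by blast
      have car: "u \<in> carrier M" "z \<in> carrier M"
        using uz submodule_carrier[OF sub(1)] submodule_carrier[OF N(1)] by blast+
      have pp: "power_product R xs \<alpha> = power_product R xs \<gamma> \<otimes> power_product R xs \<beta>"
        unfolding \<gamma>(2)[symmetric]
        by (rule R.power_product_add) (use \<beta> \<gamma>(1) xs in \<open>auto simp: exponents_def\<close>)
      have "power_product R xs \<alpha> \<odot>\<^bsub>M\<^esub> y = power_product R xs \<gamma> \<odot>\<^bsub>M\<^esub> (power_product R xs \<beta> \<odot>\<^bsub>M\<^esub> y)"
        using sub(2) yc by (simp add: pp smult_assoc1)
      also have "\<dots> = power_product R xs \<gamma> \<odot>\<^bsub>M\<^esub> u \<oplus>\<^bsub>M\<^esub> power_product R xs \<alpha> \<odot>\<^bsub>M\<^esub> z"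
        using sub(2) car by (simp add: uz(1) pp smult_r_distr smult_assoc1)
      also have "\<dots> \<in> layer xs N \<alpha>"
        unfolding layer_def
      proof (rule add_multiplesI[OF smult_monomial_span[OF xs _ \<gamma>(1) _ uz(2)] uz(3)])
        fix \<beta>' assume "\<beta>' \<in> {\<beta>' \<in> exponents (length xs). local_rank \<beta>' < local_rank \<beta>}"
        then show "\<gamma> \<oplus>\<oplus> \<beta>' \<in> {\<beta> \<in> exponents (length xs). local_rank \<beta> < local_rank \<alpha>}"
          using local_rank_add_less[OF _ \<beta> \<gamma>(1), of \<beta>'] \<gamma>
          by (simp add: exponent_add_in_exponents del: zip_map_fst_snd)
      qed auto
      finally show "power_product R xs \<alpha> \<odot>\<^bsub>M\<^esub> y \<in> layer xs N \<alpha>" .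
    qed
    moreover have "layer xs N \<alpha> \<subseteq> layer xs N' \<alpha>"
      unfolding layer_def by (intro add_multiples_mono N)
    ultimately show False using \<alpha> by blast
  qed
  then show "\<beta> \<in> {\<alpha> \<in> exponents (length xs). layer xs N \<alpha> \<noteq> layer xs N' \<alpha>}" using \<beta> by blast
qed auto

text \<open>For fixed \<open>\<alpha>\<close> the layers over \<open>N 0\<close>, ...,
  \<open>N r\<close> form simple steps, of which only the strict ones add to the length.\<close>

lemma composition_series_layers:
  assumes xs: "set xs \<subseteq> carrier R" and "\<And>i. i < r \<Longrightarrow> simple_step R M (N i) (N (Suc i))"
    and "composition_series R M A k (layer xs (N 0) \<alpha>)"
  shows "composition_series R M A
    (k + (\<Sum>i<r. of_bool (layer xs (N i) \<alpha> \<noteq> layer xs (N (Suc i)) \<alpha>))) (layer xs (N r) \<alpha>)"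
  using assms(2)
proof (induction r)
  case 0
  then show ?case using assms(3) by simp
next
  case (Suc r)
  have "simple_step R M (layer xs (N r) \<alpha>) (layer xs (N (Suc r)) \<alpha>)"
    unfolding layer_def
    by (intro simple_step_add_multiples submodule_monomial_span R.power_product_closed xs Suc.prems) simp
  moreover have "composition_series R M A
    (k + (\<Sum>i<r. of_bool (layer xs (N i) \<alpha> \<noteq> layer xs (N (Suc i)) \<alpha>))) (layer xs (N r) \<alpha>)"
    using Suc by simp
  ultimately show ?case
    using composition_series_weak_step by (metis (no_types, lifting) add.assoc sum.lessThan_Suc)
qed

lemma composition_series_monomial_span:
  assumes xs: "set xs \<subseteq> carrier R" and step: "\<And>i. i < r \<Longrightarrow> simple_step R M (N i) (N (Suc i))"
    and N0: "N 0 = monomial_span xs {\<beta> \<in> exponents (length xs). 1 \<le> sum_list \<beta>}"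
    and Nr: "N r = carrier M"
  shows "composition_series R M
    (monomial_span xs {\<beta> \<in> exponents (length xs). Suc n \<le> sum_list \<beta>})
    (\<Sum>i<r. count_upto
      {\<alpha> \<in> exponents (length xs). layer xs (N i) \<alpha> \<noteq> layer xs (N (Suc i)) \<alpha>} n)
    (carrier M)"
proof -
  let ?X = "exponents (length xs)"
  let ?E = "{\<beta> \<in> ?X. Suc n \<le> sum_list \<beta>}"
  let ?c = "\<lambda>\<alpha>. \<Sum>i<r. of_bool (layer xs (N i) \<alpha> \<noteq> layer xs (N (Suc i)) \<alpha>) :: nat"
  note sub = submodule_monomial_span[OF xs]
  \<comment> \<open>\<open>S\<close> is an initial segment of the exponents of degree at most
    \<open>n\<close>; removing its element of highest rank preserves this.\<close>
  have series: "composition_series R M (monomial_span xs ?E) (\<Sum>\<alpha>\<in>S. ?c \<alpha>) (monomial_span xs (?E \<union> S))"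
    if "finite S" "S \<subseteq> {\<alpha> \<in> ?X. sum_list \<alpha> \<le> n}"
      "\<And>\<alpha> \<beta>. \<alpha> \<in> S \<Longrightarrow> \<beta> \<in> ?X \<Longrightarrow> sum_list \<beta> \<le> n \<Longrightarrow> local_rank \<beta> < local_rank \<alpha> \<Longrightarrow> \<beta> \<in> S" for S
    using that
  proof (induction S rule: finite_ranking_induct[where f = local_rank])
    case empty
    show ?case using composition_series.base[OF sub[of ?E]] by simp
  next
    case (insert \<alpha> S)
    show ?case
    proof (cases "\<alpha> \<in> S")
      case True
      then have "insert \<alpha> S = S" by blast
      with insert show ?thesis by metis
    next
      case False
      have closed: "\<beta> \<in> S" if "\<alpha>' \<in> S" "\<beta> \<in> ?X" "sum_list \<beta> \<le> n" "local_rank \<beta> < local_rank \<alpha>'" for \<alpha>' \<beta>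
      proof -
        have "\<beta> \<noteq> \<alpha>" using insert.hyps(2)[OF that(1)] that(4) by auto
        then show ?thesis using insert.prems(2)[of \<alpha>' \<beta>] that by blast
      qed
      have \<alpha>: "\<alpha> \<in> ?X" "sum_list \<alpha> \<le> n" using insert.prems(1) by auto
      have below: "{\<beta> \<in> ?X. local_rank \<beta> < local_rank \<alpha>} = ?E \<union> S"
      proof (intro equalityI subsetI)
        fix \<beta> assume \<beta>: "\<beta> \<in> {\<beta> \<in> ?X. local_rank \<beta> < local_rank \<alpha>}"
        then show "\<beta> \<in> ?E \<union> S"
          using insert.prems(2)[of \<alpha> \<beta>] by (cases "sum_list \<beta> \<le> n") auto
      next
        fix \<beta> assume "\<beta> \<in> ?E \<union> S"
        then show "\<beta> \<in> {\<beta> \<in> ?X. local_rank \<beta> < local_rank \<alpha>}"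
        proof
          assume "\<beta> \<in> ?E"
          then show ?thesis using \<alpha> by (auto intro: local_rank_less_if_degree_greater)
        next
          assume "\<beta> \<in> S"
          then have "local_rank \<beta> \<le> local_rank \<alpha>" "\<beta> \<noteq> \<alpha>" "\<beta> \<in> ?X"
            using insert.hyps(2) insert.prems(1) False by auto
          then show ?thesis using local_rank_eq_iff[of \<beta> \<alpha>] by (simp add: order_less_le)
        qed
      qed
      have "layer xs (N 0) \<alpha> = monomial_span xs (?E \<union> S)"
        unfolding layer_def below
      proof (rule antisym)
        show "add_multiples (power_product R xs \<alpha>) (monomial_span xs (?E \<union> S)) (N 0)
          \<subseteq> monomial_span xs (?E \<union> S)"
        proof (rule add_multiples_minimal[OF sub order_refl])
          fix y assume "y \<in> N 0"
          then show "power_product R xs \<alpha> \<odot>\<^bsub>M\<^esub> y \<in> monomial_span xs (?E \<union> S)"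
            unfolding N0 below[symmetric]
            by (rule smult_monomial_span[OF xs _ \<alpha>(1), rotated -1])
               (use \<alpha>(1) in \<open>auto intro!: local_rank_less_if_degree_greater
                 simp: exponents_def sum_list_exponent_add\<close>)
        qed
        show "monomial_span xs (?E \<union> S)
          \<subseteq> add_multiples (power_product R xs \<alpha>) (monomial_span xs (?E \<union> S)) (N 0)"
          unfolding N0 by (intro add_multiples_superset sub R.power_product_closed xs)
      qed
      moreover have "composition_series R M (monomial_span xs ?E) (\<Sum>\<alpha>\<in>S. ?c \<alpha>) (monomial_span xs (?E \<union> S))"
        by (rule insert.IH) (use insert.prems(1) closed in auto)
      ultimately have "composition_series R M (monomial_span xs ?E)
          ((\<Sum>\<alpha>\<in>S. ?c \<alpha>) + ?c \<alpha>) (layer xs (N r) \<alpha>)"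
        by (intro composition_series_layers[where N = N, OF xs]) (simp_all add: step)
      moreover have "layer xs (N r) \<alpha> = monomial_span xs (?E \<union> insert \<alpha> S)"
        by (simp add: layer_def below Nr monomial_span_insert[OF xs])
      ultimately show ?thesis using insert.hyps(1) False by (simp add: add.commute)
    qed
  qed
  let ?S = "{\<alpha> \<in> ?X. sum_list \<alpha> \<le> n}"
  have "composition_series R M (monomial_span xs ?E) (\<Sum>\<alpha>\<in>?S. ?c \<alpha>) (monomial_span xs (?E \<union> ?S))"
    by (rule series) (auto simp: finite_exponents_upto)
  \<comment> \<open>The zero exponent is included, and its monomial is 1.\<close>
  moreover have "monomial_span xs (?E \<union> ?S) = carrier M"
  proof (rule antisym)
    show "monomial_span xs (?E \<union> ?S) \<subseteq> carrier M" by (rule submoduleE(1)[OF sub])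
    show "carrier M \<subseteq> monomial_span xs (?E \<union> ?S)"
    proof
      fix y assume y: "y \<in> carrier M"
      then have "y = power_product R xs (replicate (length xs) 0) \<odot>\<^bsub>M\<^esub> y"
        using xs by (simp add: R.power_product_zero)
      also have "\<dots> \<in> monomial_span xs (?E \<union> ?S)"
        using y by (intro monomial_spanI) (auto simp: exponents_def sum_list_replicate)
      finally show "y \<in> monomial_span xs (?E \<union> ?S)" .
    qed
  qed
  moreover have "(\<Sum>\<alpha>\<in>?S. ?c \<alpha>) =
      (\<Sum>i<r. count_upto {\<alpha> \<in> ?X. layer xs (N i) \<alpha> \<noteq> layer xs (N (Suc i)) \<alpha>} n)"
  proof -
    have "(\<Sum>\<alpha>\<in>?S. ?c \<alpha>) =
        (\<Sum>i<r. \<Sum>\<alpha>\<in>?S. of_bool (layer xs (N i) \<alpha> \<noteq> layer xs (N (Suc i)) \<alpha>))"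
      by (rule sum.swap)
    also have "\<dots> = (\<Sum>i<r. count_upto {\<alpha> \<in> ?X. layer xs (N i) \<alpha> \<noteq> layer xs (N (Suc i)) \<alpha>} n)"
      unfolding count_upto_def
      by (intro sum.cong refl, subst sum_of_bool_eq)
         (auto simp: finite_exponents_upto intro!: arg_cong[where f = card])
    finally show ?thesis .
  qed
  ultimately show ?thesis by metis
qed

end

section \<open>Hilbert coefficients\<close>

lemma degree_binomial_poly: "degree (binomial_poly k) = k" and binomial_poly_nonzero: "binomial_poly k \<noteq> 0"
proof -
  have "degree (pochhammer [:1, 1:] k :: rat poly) = k \<and> (pochhammer [:1, 1:] k :: rat poly) \<noteq> 0"
  proof (induction k)
    case (Suc k)
    have "[:1, 1:] + of_nat k = [:1 + of_nat k, 1 :: rat:]" by (simp add: of_nat_poly)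
    then show ?case using Suc by (simp add: pochhammer_Suc degree_mult_eq del: mult_pCons_right)
  qed simp
  then show "degree (binomial_poly k) = k" "binomial_poly k \<noteq> 0" by (simp_all add: binomial_poly_def)
qed

text \<open>The degrees are distinct, so the coefficient in the highest degree isolates
  \<open>a (Suc d)\<close>.\<close>

lemma binomial_poly_independent:
  assumes "(\<Sum>k\<le>d. Polynomial.smult (a k) (binomial_poly k)) = 0" and "k \<le> d"
  shows "a k = 0"
  using assms
proof (induction d)
  case 0
  then show ?case using binomial_poly_nonzero[of 0] by simp
next
  case (Suc d)
  have "Polynomial.coeff (\<Sum>k\<le>Suc d. Polynomial.smult (a k) (binomial_poly k)) (Suc d) =
      a (Suc d) * Polynomial.coeff (binomial_poly (Suc d)) (Suc d)"
    by (simp add: coeff_sum coeff_eq_0 degree_binomial_poly)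
  moreover have "Polynomial.coeff (binomial_poly (Suc d)) (Suc d) \<noteq> 0"
    using binomial_poly_nonzero[of "Suc d"] degree_binomial_poly[of "Suc d"] by (metis leading_coeff_neq_0)
  ultimately have "a (Suc d) = 0"
    unfolding Suc.prems(1) Polynomial.coeff_0 by (metis mult_eq_0_iff)
  then show ?case using Suc by (cases "k = Suc d") auto
qed

text \<open>A competing polynomial differs from \<open>?P\<close> by one with infinitely many roots,
  hence by zero; this settles the definite description.\<close>

lemma hilbert_poly_eq:
  assumes h: "\<And>n. hilbert_function R J M n = enat (h n)"
    and c: "eventually_binomial (Suc d) c (\<lambda>n. int (h n))"
  shows "hilbert_poly R J M = (\<Sum>k\<le>d. Polynomial.smult (of_int (c k)) (binomial_poly k))"
    (is "_ = ?P")
  unfolding hilbert_poly_def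
proof (rule the_equality)
  have P: "\<forall>\<^sub>F n in sequentially. poly ?P (of_nat n) = of_nat (h n)"
    using c unfolding eventually_binomial_def
  proof eventually_elim
    case (elim n)
    have "of_nat (h n) = (of_int (int (h n)) :: rat)" by simp
    also have "\<dots> = poly ?P (of_nat n)"
      unfolding elim by (simp add: poly_sum poly_binomial_poly lessThan_Suc_atMost)
    finally show ?case ..
  qed
  then show "\<forall>\<^sub>F n in sequentially. \<exists>l. hilbert_function R J M n = enat l \<and> poly ?P (of_nat n) = of_nat l"
    by eventually_elim (simp add: h)
  fix Q :: "rat poly"
  assume "\<forall>\<^sub>F n in sequentially. \<exists>l. hilbert_function R J M n = enat l \<and> poly Q (of_nat n) = of_nat l"
  with P have "\<forall>\<^sub>F n in sequentially. poly (Q - ?P) (of_nat n) = 0"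
    by eventually_elim (auto simp: h)
  then obtain N where N: "\<And>n. n \<ge> N \<Longrightarrow> poly (Q - ?P) (of_nat n) = 0"
    unfolding eventually_sequentially by blast
  have "infinite ((of_nat :: nat \<Rightarrow> rat) ` {N..})"
    by (simp add: finite_image_iff inj_on_def infinite_Ici)
  moreover have "of_nat ` {N..} \<subseteq> {x. poly (Q - ?P) x = 0}" using N by auto
  ultimately have "infinite {x. poly (Q - ?P) x = 0}" using finite_subset by blast
  then show "Q = ?P" using poly_roots_finite[of "Q - ?P"] by auto
qed

text \<open>Comparison of coefficients in the independent family \<open>binomial_poly\<close> shows
  that no other sequence satisfies the description.\<close>

lemma hilbert_coeff_eq:
  assumes "\<And>n. hilbert_function R J M n = enat (h n)"
    and "eventually_binomial (Suc d) c (\<lambda>n. int (h n))"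
    and d: "module_dim R M = enat d"
  shows "hilbert_coeff R J M = (\<lambda>i. if i \<le> d then (-1) ^ i * c (d - i) else 0)" (is "_ = ?e")
proof -
  note poly = hilbert_poly_eq[OF assms(1,2)]
  \<comment> \<open>The substitution \<open>k = d - i\<close> passes to the indexing of
    \<open>c\<close>.\<close>
  have rev: "(\<Sum>i\<le>d. Polynomial.smult ((-1) ^ i * of_int (e i)) (binomial_poly (d - i))) =
      (\<Sum>k\<le>d. Polynomial.smult ((-1) ^ (d - k) * of_int (e (d - k))) (binomial_poly k))"
    for e :: "nat \<Rightarrow> int"
    by (rule sum.reindex_bij_witness[of _ "\<lambda>k. d - k" "\<lambda>i. d - i"]) auto
  show ?thesis
    unfolding hilbert_coeff_def d the_enat.simps Let_def poly rev
  proof (rule the_equality)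
    show "(\<Sum>k\<le>d. Polynomial.smult (of_int (c k)) (binomial_poly k)) =
        (\<Sum>k\<le>d. Polynomial.smult ((-1) ^ (d - k) * of_int (?e (d - k))) (binomial_poly k)) \<and>
        (\<forall>i>d. ?e i = 0)"
      by (auto intro!: sum.cong simp: power_mult_distrib[symmetric])
    fix e :: "nat \<Rightarrow> int"
    assume e: "(\<Sum>k\<le>d. Polynomial.smult (of_int (c k)) (binomial_poly k)) =
        (\<Sum>k\<le>d. Polynomial.smult ((-1) ^ (d - k) * of_int (e (d - k))) (binomial_poly k)) \<and>
        (\<forall>i>d. e i = 0)"
    have "(\<Sum>k\<le>d. Polynomial.smult (of_int (c k) - (-1) ^ (d - k) * of_int (e (d - k)))
        (binomial_poly k)) = 0"
      using e by (simp add: smult_diff_left sum_subtractf)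
    from binomial_poly_independent[OF this]
    have c: "(of_int (c k) :: rat) = of_int ((-1) ^ (d - k) * e (d - k))" if "k \<le> d" for k
      using that by simp
    have "e i = ?e i" for i
    proof (cases "i \<le> d")
      case True
      then have "c (d - i) = (-1) ^ i * e i"
        using c[of "d - i"] unfolding of_int_eq_iff by simp
      then show ?thesis using True by (simp add: mult.assoc[symmetric] power_mult_distrib[symmetric])
    qed (use e in auto)
    then show "e = ?e" by blast
  qed
qed

text \<open>Finite length of \<open>M/JM\<close> provides a composition series, and each of its
  steps a down-set. Their counts and coefficients add up, which preserves the sign at
  \<open>length xs - 1\<close>.\<close>

lemma (in module) hilbert_function_eventually_binomial:
  assumes xs: "set xs \<subseteq> carrier R" and "xs \<noteq> []" and J: "J = genideal R (set xs)"
    and finite: "module_length R (quotient_module M (ideal_smult R J M)) < \<infinity>"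
  shows "\<exists>h c. (\<forall>n. hilbert_function R J M n = enat (h n)) \<and>
    eventually_binomial (Suc (length xs)) c (\<lambda>n. int (h n)) \<and> c (length xs - 1) \<ge> 0"
proof -
  have JM: "ideal_smult R J M = monomial_span xs {\<beta> \<in> exponents (length xs). 1 \<le> sum_list \<beta>}"
    using ideal_smult_power[OF xs J, of 1] R.ideal_power_1[of J] R.genideal_ideal[OF xs] by (simp add: J)
  have "submodule (ideal_smult R J M) R M" unfolding JM by (rule submodule_monomial_span[OF xs])
  from composition_series_of_finite_length[OF this finite]
  obtain r where "composition_series R M (ideal_smult R J M) r (carrier M)" ..
  from composition_series_terms[OF this] obtain N
    where N: "N 0 = ideal_smult R J M" "N r = carrier M"
      "\<And>i. i < r \<Longrightarrow> simple_step R M (N i) (N (Suc i))" by blast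
  define D where "D i = {\<alpha> \<in> exponents (length xs). layer xs (N i) \<alpha> \<noteq> layer xs (N (Suc i)) \<alpha>}" for i
  define h where "h n = (\<Sum>i<r. count_upto (D i) n)" for n
  have "hilbert_function R J M n = enat (h n)" for n
    unfolding hilbert_function_def ideal_smult_power[OF xs J] h_def D_def
    by (intro module_length_quotient_eq composition_series_monomial_span xs N(3) N(1)[unfolded JM] N(2))
  moreover have "\<exists>c. eventually_binomial (Suc (length xs)) c (\<lambda>n. int (h n)) \<and> c (length xs - 1) \<ge> 0"
  proof -
    have "\<exists>c. eventually_binomial (Suc (length xs)) c (\<lambda>n. int (count_upto (D i) n)) \<and>
        c (length xs - 1) \<ge> 0" if "i < r" for i
      unfolding D_def using assms(2) by (intro count_upto_down_set down_set_layer xs N(3) that) simp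
    then obtain c where c: "\<And>i. i < r \<Longrightarrow>
        eventually_binomial (Suc (length xs)) (c i) (\<lambda>n. int (count_upto (D i) n))"
        "\<And>i. i < r \<Longrightarrow> c i (length xs - 1) \<ge> 0"
      by metis
    have "eventually_binomial (Suc (length xs)) (\<lambda>k. \<Sum>i<r. c i k)
        (\<lambda>n. \<Sum>i<r. int (count_upto (D i) n))"
      using c(1) by (intro eventually_binomial_sum) auto
    moreover have "(\<Sum>i<r. c i (length xs - 1)) \<ge> 0" using c(2) by (intro sum_nonneg) auto
    ultimately show ?thesis by (intro exI[of _ "\<lambda>k. \<Sum>i<r. c i k"]) (simp add: h_def)
  qed
  ultimately show ?thesis by blast
qed

theorem theorem3p5:
  fixes R :: "('a, 'r) ring_scheme" and M :: "('a, 'b, 'm) module_scheme"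
    and \<mm> J :: "'a set" and xs :: "'a list" and d :: nat
  assumes "noetherian_local_ring R \<mm>"
    and "finite_module R M"
    and "module_dim R M = enat d" and "d \<ge> 1"
    and "system_of_parameters R \<mm> M xs"
    and "J = genideal R (set xs)"
  shows "chern_number R J M \<le> 0"
proof -
  interpret noetherian_local_ring R \<mm> by (rule assms(1))
  interpret \<mm>: maximalideal \<mm> R by (rule maximal)
  interpret module R M using assms(2) by (simp add: finite_module_def)
  have len: "length xs = d" and "set xs \<subseteq> \<mm>"
    and finite: "module_length R (quotient_module M (ideal_smult R J M)) < \<infinity>"
    using assms(3,5,6) by (auto simp: system_of_parameters_def)
  then have xs: "set xs \<subseteq> carrier R" "xs \<noteq> []" using \<mm>.Icarr assms(4) by auto
  obtain h c where "\<And>n. hilbert_function R J M n = enat (h n)"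
      "eventually_binomial (Suc d) c (\<lambda>n. int (h n))" and c: "c (d - 1) \<ge> 0"
    using hilbert_function_eventually_binomial[OF xs assms(6) finite] unfolding len by metis
  \<comment> \<open>Since \<open>d \<ge> 1\<close>, the index 1 is in range and
    \<open>e_1 = - c (d - 1)\<close>.\<close>
  from hilbert_coeff_eq[OF this(1,2) assms(3)] show ?thesis
    using c assms(4) by (simp add: chern_number_def)
qed

end
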